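(* Suppose given a recollement of triangulated categories with $i\colon\mathcal{N}\hookrightarrow\mathcal{C}$, $\ell\colon\mathcal{C}\to\mathcal{C}_{\mathcal{N}}$, adjoints $i^{\ast}\dashv i\dashv i^{!}$ and $j_!\dashv\ell\dashv j_{\ast}$; let $(\mathcal{S},\mathcal{V})$ be a cotorsion pair on $\mathcal{N}$, and let $\mathcal{P}=((\mathcal{S},\mathcal{T}),(\mathcal{U},\mathcal{V}))$ be the associated Hovey twin cotorsion pair on $\mathcal{C}$, where $\mathcal{U}=(i^{\ast})^{-1}(\mathcal{S})$ and $\mathcal{T}=(i^{!})^{-1}(\mathcal{V})$. Then $\mathfrak{M}_{\mathcal{P}}=\mathfrak{M}'_{(\mathcal{S},\mathcal{V})}$, and the maps $\mathbf{R}_{(\mathcal{S},\mathcal{V})}$ and $\mathbf{I}_{(\mathcal{S},\mathcal{V})}$ agree with the maps $\mathbf{R}_{\mathcal{P}}$ and $\mathbf{I}_{\mathcal{P}}$, respectively.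
   Context: For a triangulated category $\mathcal{C}$ with shift $[1]$, $\mathrm{Ext}^1_{\mathcal{C}}(X,Y)=\mathcal{C}(X,Y[1])$. For full subcategories $\mathcal{X},\mathcal{Y}\subseteq\mathcal{C}$, $\mathcal{X}\ast\mathcal{Y}$ is the full subcategory of objects $C$ admitting a distinguished triangle $X\to C\to Y\to X[1]$ with $X\in\mathcal{X},Y\in\mathcal{Y}$. A cotorsion pair on $\mathcal{C}$ is a pair $(\mathcal{U},\mathcal{V})$ of full additive subcategories closed under isomorphisms and direct summands with $\mathcal{C}=\mathcal{U}\ast\mathcal{V}[1]$ and $\mathrm{Ext}^1_{\mathcal{C}}(\mathcal{U},\mathcal{V})=0$; $\mathfrak{CP}(\mathcal{C})$ is the class of cotorsion pairs on $\mathcal{C}$. A twin cotorsion pair (TCP) on $\mathcal{C}$ is a pair $((\mathcal{S},\mathcal{T}),(\mathcal{U},\mathcal{V}))$ of cotorsion pairs on $\mathcal{C}$ with $\mathrm{Ext}^1_{\mathcal{C}}(\mathcal{S},\mathcal{V})=0$. It is a Hovey TCP if $\mathcal{S}\ast\mathcal{V}[1]=\mathcal{S}[-1]\ast\mathcal{V}$. A Hovey TCP is concentric: $\mathcal{S}\cap\mathcal{T}=\mathcal{U}\cap\mathcal{V}=:\mathcal{I}$; put $\mathcal{Z}=\mathcal{T}\cap\mathcal{U}$. Recollement: $\mathcal{N}$ is a full triangulated subcategory of $\mathcal{C}$ closed under isomorphisms with inclusion $i$, $\ell\colon\mathcal{C}\to\mathcal{C}_{\mathcal{N}}$ is the Verdier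 quotient, all functors $i,i^{\ast},i^!,\ell,j_!,j_{\ast}$ are triangle functors, $i^{\ast}\dashv i\dashv i^!$ and $j_!\dashv\ell\dashv j_{\ast}$, the functors $i,j_!,j_{\ast}$ are fully faithful, $\ell\circ i=0$, and for every $C\in\mathcal{C}$ the units and counits give distinguished triangles $ii^!C\to C\to j_{\ast}\ell C\to(ii^!C)[1]$ and $j_!\ell C\to C\to ii^{\ast}C\to(j_!\ell C)[1]$. For $\mathcal{I}\subseteq\mathcal{X}\subseteq\mathcal{C}$, $\mathcal{X}/\mathcal{I}$ is the ideal quotient (morphisms modulo those factoring through $\mathcal{I}$). The inclusion $\mathcal{Z}/\mathcal{I}\hookrightarrow\mathcal{U}/\mathcal{I}$ has a left adjoint $\sigma$ (for a triangle $S[-1]\to U\to Z\to S$ with $S\in\mathcal{S}$, $Z\in\mathcal{Z}$, $\sigma(U)=Z$), and $\mathcal{Z}/\mathcal{I}\hookrightarrow\mathcal{T}/\mathcal{I}$ has a right adjoint $\omega$ (for a triangle $V\to Z\to T\to V[1]$ with $V\in\mathcal{V}$, $Z\in\mathcal{Z}$, $\omega(T)=Z$). For $Z\in\mathcal{Z}$ choose a triangle $Z\to I\to U\to Z[1]$ with $I\in\mathcal{I}$, $U\in\mathcal{U}$ and put $Z\langle1\rangle=U$ (morphisms: $\underline{z}\mapsto\underline{u}$ for a morphism $(z,i,u)$ of chosen triangles); this gives a functor $\langle1\rangle\colon\mathcal{Z}/\mathcal{I}\to\mathcal{U}/\mathcal{I}$. Put $\Sigma=\sigma\circ\langle1\rangle$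 and $\mathrm{Ext}^1_{\mathcal{Z}/\mathcal{I}}(X,Y)=(\mathcal{Z}/\mathcal{I})(X,\Sigma Y)$. The two classes are $$\mathfrak{M}_{\mathcal{P}}=\{(\mathcal{A},\mathcal{B})\in\mathfrak{CP}(\mathcal{C})\mid \mathcal{S}\subseteq\mathcal{A}\subseteq\mathcal{U},\ \mathcal{V}\subseteq\mathcal{B}\subseteq\mathcal{T},\ \mathrm{Ext}^1_{\mathcal{Z}/\mathcal{I}}(\sigma(\mathcal{A}/\mathcal{I}),\omega(\mathcal{B}/\mathcal{I}))=0\},$$ $$\mathfrak{M}'_{(\mathcal{S},\mathcal{V})}=\{(\mathcal{A},\mathcal{B})\in\mathfrak{CP}(\mathcal{C})\mid \mathcal{S}\subseteq\mathcal{A}\subseteq{}^{\perp}\mathcal{V}[1],\ \mathcal{V}\subseteq\mathcal{B}\subseteq\mathcal{S}[-1]^{\perp},\ \mathrm{Ext}^1_{\mathcal{C}_{\mathcal{N}}}(\ell(\mathcal{A}),\ell(\mathcal{B}))=0\},$$ where $\mathcal{S}[-1]^{\perp}=\{C\mid\mathcal{C}(\mathcal{S}[-1],C)=0\}$ and ${}^{\perp}\mathcal{V}[1]=\{C\mid\mathcal{C}(C,\mathcal{V}[1])=0\}$. The maps (with $\ell(\mathcal{A}),\ell(\mathcal{B})$ denoting essential images in $\mathcal{C}_{\mathcal{N}}$) are $\mathbf{R}_{\mathcal{P}}\colon\mathfrak{M}_{\mathcal{P}}\to\mathfrak{CP}(\mathcal{C}_{\mathcal{N}})$, $(\mathcal{A},\mathcal{B})\mapsto(\ell(\mathcal{A}),\ell(\mathcal{B}))$;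 $\mathbf{I}_{\mathcal{P}}\colon\mathfrak{CP}(\mathcal{C}_{\mathcal{N}})\to\mathfrak{M}_{\mathcal{P}}$, $(\mathscr{E},\mathscr{F})\mapsto(\mathcal{U}\cap\ell^{-1}(\mathscr{E}),\mathcal{T}\cap\ell^{-1}(\mathscr{F}))$; $\mathbf{R}_{(\mathcal{S},\mathcal{V})}\colon\mathfrak{M}'_{(\mathcal{S},\mathcal{V})}\to\mathfrak{CP}(\mathcal{C}_{\mathcal{N}})$, $(\mathcal{A},\mathcal{B})\mapsto(\ell(\mathcal{A}),\ell(\mathcal{B}))$; $\mathbf{I}_{(\mathcal{S},\mathcal{V})}\colon\mathfrak{CP}(\mathcal{C}_{\mathcal{N}})\to\mathfrak{M}'_{(\mathcal{S},\mathcal{V})}$, $(\mathscr{E},\mathscr{F})\mapsto((i^{\ast})^{-1}(\mathcal{S})\cap\ell^{-1}(\mathscr{E}),(i^{!})^{-1}(\mathcal{V})\cap\ell^{-1}(\mathscr{F}))$. (Each is a well-defined map; the two maps in each pair are mutually inverse bijections.) *)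

theory Defs
  imports "HOL-Algebra.Group"
begin

section \<open>Categories\<close>

text \<open>Only the hom-sets between members of \<^term>\<open>Obj\<close> are meaningful. Hence a full subcategory
  is obtained by shrinking \<^term>\<open>Obj\<close> alone, and full subcategories are identified with sets of objects.\<close>

record ('o, 'm) cat =
  Obj :: "'o set"
  Hom :: "'o \<Rightarrow> 'o \<Rightarrow> 'm set"
  Idn :: "'o \<Rightarrow> 'm"
  Cmp :: "'m \<Rightarrow> 'm \<Rightarrow> 'm"  (infixl \<open>\<cdot>\<index>\<close> 70)

locale category =
  fixes C :: "('o, 'm, 'x) cat_scheme" (structure)
  assumes Hom_disjoint:
      "\<lbrakk>X \<in> Obj C; Y \<in> Obj C; X' \<in> Obj C; Y' \<in> Obj C; f \<in> Hom C X Y; f \<in> Hom C X' Y'\<rbrakk>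
        \<Longrightarrow> X = X' \<and> Y = Y'"
    and Idn_in_Hom: "X \<in> Obj C \<Longrightarrow> Idn C X \<in> Hom C X X"
    and Cmp_in_Hom:
      "\<lbrakk>X \<in> Obj C; Y \<in> Obj C; Z \<in> Obj C; f \<in> Hom C X Y; g \<in> Hom C Y Z\<rbrakk> \<Longrightarrow> g \<cdot> f \<in> Hom C X Z"
    and Cmp_Idn: "\<lbrakk>X \<in> Obj C; Y \<in> Obj C; f \<in> Hom C X Y\<rbrakk> \<Longrightarrow> f \<cdot> Idn C X = f"
    and Idn_Cmp: "\<lbrakk>X \<in> Obj C; Y \<in> Obj C; f \<in> Hom C X Y\<rbrakk> \<Longrightarrow> Idn C Y \<cdot> f = f"
    and Cmp_assoc:
      "\<lbrakk>W \<in> Obj C; X \<in> Obj C; Y \<in> Obj C; Z \<in> Obj C; f \<in> Hom C W X; g \<in> Hom C X Y; h \<in> Hom C Y Z\<rbrakk>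
        \<Longrightarrow> h \<cdot> (g \<cdot> f) = (h \<cdot> g) \<cdot> f"

definition iso_arr :: "('o, 'm, 'x) cat_scheme \<Rightarrow> 'o \<Rightarrow> 'o \<Rightarrow> 'm \<Rightarrow> bool" where
  "iso_arr C X Y f \<longleftrightarrow> f \<in> Hom C X Y \<and>
     (\<exists>g\<in>Hom C Y X. g \<cdot>\<^bsub>C\<^esub> f = Idn C X \<and> f \<cdot>\<^bsub>C\<^esub> g = Idn C Y)"

definition isomorphic :: "('o, 'm, 'x) cat_scheme \<Rightarrow> 'o \<Rightarrow> 'o \<Rightarrow> bool" where
  "isomorphic C X Y \<longleftrightarrow> (\<exists>f. iso_arr C X Y f)"

definition iso_closed :: "('o, 'm, 'x) cat_scheme \<Rightarrow> 'o set \<Rightarrow> bool" where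
  "iso_closed C A \<longleftrightarrow> (\<forall>X\<in>A. \<forall>Y\<in>Obj C. isomorphic C X Y \<longrightarrow> Y \<in> A)"

definition full_sub :: "('o, 'm, 'x) cat_scheme \<Rightarrow> 'o set \<Rightarrow> ('o, 'm, 'x) cat_scheme" where
  "full_sub C A = C\<lparr>Obj := A\<rparr>"


section \<open>Functors and adjunctions\<close>

record ('o, 'm, 'p, 'n) fctr =
  FO :: "'o \<Rightarrow> 'p"
  FM :: "'m \<Rightarrow> 'n"

definition incl_fctr :: "('o, 'm, 'o, 'm) fctr" where
  "incl_fctr = \<lparr>FO = (\<lambda>X. X), FM = (\<lambda>f. f)\<rparr>"

definition comp_fctr ::
  "('p, 'n, 'q, 'k) fctr \<Rightarrow> ('o, 'm, 'p, 'n) fctr \<Rightarrow> ('o, 'm, 'q, 'k) fctr" where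
  "comp_fctr G F = \<lparr>FO = FO G \<circ> FO F, FM = FM G \<circ> FM F\<rparr>"

locale cat_functor = A: category A + B: category B
  for A :: "('o, 'm, 'x) cat_scheme" and B :: "('p, 'n, 'y) cat_scheme" +
  fixes F :: "('o, 'm, 'p, 'n) fctr"
  assumes FO_in_Obj: "X \<in> Obj A \<Longrightarrow> FO F X \<in> Obj B"
    and FM_in_Hom:
      "\<lbrakk>X \<in> Obj A; Y \<in> Obj A; f \<in> Hom A X Y\<rbrakk> \<Longrightarrow> FM F f \<in> Hom B (FO F X) (FO F Y)"
    and FM_Idn: "X \<in> Obj A \<Longrightarrow> FM F (Idn A X) = Idn B (FO F X)"
    and FM_Cmp:
      "\<lbrakk>X \<in> Obj A; Y \<in> Obj A; Z \<in> Obj A; f \<in> Hom A X Y; g \<in> Hom A Y Z\<rbrakk>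
        \<Longrightarrow> FM F (g \<cdot>\<^bsub>A\<^esub> f) = FM F g \<cdot>\<^bsub>B\<^esub> FM F f"

definition fully_faithful ::
  "('o, 'm, 'x) cat_scheme \<Rightarrow> ('p, 'n, 'y) cat_scheme \<Rightarrow> ('o, 'm, 'p, 'n) fctr \<Rightarrow> bool" where
  "fully_faithful A B F \<longleftrightarrow>
     (\<forall>X\<in>Obj A. \<forall>Y\<in>Obj A. bij_betw (FM F) (Hom A X Y) (Hom B (FO F X) (FO F Y)))"

text \<open>The functor \<open>F\<close> is left adjoint to \<open>G\<close> with unit \<open>\<eta>\<close> and counit \<open>\<epsilon>\<close>.\<close>

locale adjunction = F: cat_functor A B F + G: cat_functor B A G
  for A :: "('o, 'm, 'x) cat_scheme" and B :: "('p, 'n, 'y) cat_scheme"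
    and F :: "('o, 'm, 'p, 'n) fctr" and G :: "('p, 'n, 'o, 'm) fctr" +
  fixes \<eta> :: "'o \<Rightarrow> 'm" and \<epsilon> :: "'p \<Rightarrow> 'n"
  assumes unit_in_Hom: "X \<in> Obj A \<Longrightarrow> \<eta> X \<in> Hom A X (FO G (FO F X))"
    and unit_natural:
      "\<lbrakk>X \<in> Obj A; X' \<in> Obj A; f \<in> Hom A X X'\<rbrakk> \<Longrightarrow> FM G (FM F f) \<cdot>\<^bsub>A\<^esub> \<eta> X = \<eta> X' \<cdot>\<^bsub>A\<^esub> f"
    and counit_in_Hom: "Y \<in> Obj B \<Longrightarrow> \<epsilon> Y \<in> Hom B (FO F (FO G Y)) Y"
    and counit_natural:
      "\<lbrakk>Y \<in> Obj B; Y' \<in> Obj B; g \<in> Hom B Y Y'\<rbrakk> \<Longrightarrow> \<epsilon> Y' \<cdot>\<^bsub>B\<^esub> FM F (FM G g) = g \<cdot>\<^bsub>B\<^esub> \<epsilon> Y"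
    and triangle_F: "X \<in> Obj A \<Longrightarrow> \<epsilon> (FO F X) \<cdot>\<^bsub>B\<^esub> FM F (\<eta> X) = Idn B (FO F X)"
    and triangle_G: "Y \<in> Obj B \<Longrightarrow> FM G (\<epsilon> Y) \<cdot>\<^bsub>A\<^esub> \<eta> (FO G Y) = Idn A (FO G Y)"

definition ess_image ::
  "('p, 'n, 'y) cat_scheme \<Rightarrow> ('o, 'm, 'p, 'n) fctr \<Rightarrow> 'o set \<Rightarrow> 'p set" where
  "ess_image B F \<A> = {Y \<in> Obj B. \<exists>X\<in>\<A>. isomorphic B (FO F X) Y}"

definition preimage ::
  "('o, 'm, 'x) cat_scheme \<Rightarrow> ('o, 'm, 'p, 'n) fctr \<Rightarrow> 'p set \<Rightarrow> 'o set" where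
  "preimage A F \<E> = {X \<in> Obj A. FO F X \<in> \<E>}"


section \<open>Additive categories\<close>

record ('o, 'm) addcat = "('o, 'm) cat" +
  Add :: "'m \<Rightarrow> 'm \<Rightarrow> 'm"  (infixl \<open>\<oplus>\<index>\<close> 65)
  Zero :: "'o \<Rightarrow> 'o \<Rightarrow> 'm"

definition hom_group :: "('o, 'm, 'x) addcat_scheme \<Rightarrow> 'o \<Rightarrow> 'o \<Rightarrow> 'm monoid" where
  "hom_group C X Y = \<lparr>carrier = Hom C X Y, monoid.mult = Add C, one = Zero C X Y\<rparr>"

definition Neg :: "('o, 'm, 'x) addcat_scheme \<Rightarrow> 'o \<Rightarrow> 'o \<Rightarrow> 'm \<Rightarrow> 'm" where
  "Neg C X Y f = m_inv (hom_group C X Y) f"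

definition hom_zero :: "('o, 'm, 'x) addcat_scheme \<Rightarrow> 'o \<Rightarrow> 'o \<Rightarrow> bool" where
  "hom_zero C X Y \<longleftrightarrow> Hom C X Y = {Zero C X Y}"

definition zero_obj :: "('o, 'm, 'x) addcat_scheme \<Rightarrow> 'o \<Rightarrow> bool" where
  "zero_obj C X \<longleftrightarrow> X \<in> Obj C \<and> Idn C X = Zero C X X"

definition direct_sum :: "('o, 'm, 'x) addcat_scheme \<Rightarrow> 'o \<Rightarrow> 'o \<Rightarrow> 'o \<Rightarrow> bool" where
  "direct_sum C X Y Z \<longleftrightarrow> X \<in> Obj C \<and> Y \<in> Obj C \<and> Z \<in> Obj C \<and>
     (\<exists>i\<in>Hom C X Z. \<exists>j\<in>Hom C Y Z. \<exists>p\<in>Hom C Z X. \<exists>q\<in>Hom C Z Y.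
        p \<cdot>\<^bsub>C\<^esub> i = Idn C X \<and> q \<cdot>\<^bsub>C\<^esub> j = Idn C Y \<and>
        p \<cdot>\<^bsub>C\<^esub> j = Zero C Y X \<and> q \<cdot>\<^bsub>C\<^esub> i = Zero C X Y \<and>
        (i \<cdot>\<^bsub>C\<^esub> p) \<oplus>\<^bsub>C\<^esub> (j \<cdot>\<^bsub>C\<^esub> q) = Idn C Z)"

locale additive_category = category C
  for C :: "('o, 'm, 'x) addcat_scheme" (structure) +
  assumes hom_comm_group: "\<lbrakk>X \<in> Obj C; Y \<in> Obj C\<rbrakk> \<Longrightarrow> comm_group (hom_group C X Y)"
    and Cmp_Add_right:
      "\<lbrakk>X \<in> Obj C; Y \<in> Obj C; Z \<in> Obj C; f \<in> Hom C X Y; f' \<in> Hom C X Y; g \<in> Hom C Y Z\<rbrakk>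
        \<Longrightarrow> g \<cdot> (f \<oplus> f') = (g \<cdot> f) \<oplus> (g \<cdot> f')"
    and Cmp_Add_left:
      "\<lbrakk>X \<in> Obj C; Y \<in> Obj C; Z \<in> Obj C; f \<in> Hom C X Y; g \<in> Hom C Y Z; g' \<in> Hom C Y Z\<rbrakk>
        \<Longrightarrow> (g \<oplus> g') \<cdot> f = (g \<cdot> f) \<oplus> (g' \<cdot> f)"
    and zero_obj_exists: "\<exists>X. zero_obj C X"
    and direct_sum_exists: "\<lbrakk>X \<in> Obj C; Y \<in> Obj C\<rbrakk> \<Longrightarrow> \<exists>Z. direct_sum C X Y Z"

definition add_summand_closed :: "('o, 'm, 'x) addcat_scheme \<Rightarrow> 'o set \<Rightarrow> bool" where
  "add_summand_closed C A \<longleftrightarrow> A \<subseteq> Obj C \<and> iso_closed C A \<and> (\<exists>X\<in>A. zero_obj C X) \<and>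
     (\<forall>X\<in>A. \<forall>Y\<in>A. \<forall>Z. direct_sum C X Y Z \<longrightarrow> Z \<in> A) \<and>
     (\<forall>X Y. \<forall>Z\<in>A. direct_sum C X Y Z \<longrightarrow> X \<in> A)"

locale additive_functor = cat_functor A B F + A: additive_category A + B: additive_category B
  for A :: "('o, 'm, 'x) addcat_scheme" and B :: "('p, 'n, 'y) addcat_scheme"
    and F :: "('o, 'm, 'p, 'n) fctr" +
  assumes FM_Add:
      "\<lbrakk>X \<in> Obj A; Y \<in> Obj A; f \<in> Hom A X Y; g \<in> Hom A X Y\<rbrakk>
        \<Longrightarrow> FM F (f \<oplus>\<^bsub>A\<^esub> g) = FM F f \<oplus>\<^bsub>B\<^esub> FM F g"


section \<open>Ideal quotients\<close>

text \<open>The relation \<open>ideal_eq C \<I> f g\<close> says that \<open>f\<close> and \<open>g\<close> are parallel and that their difference factors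
  through an object of \<open>\<I>\<close>. The morphisms of the quotient are the classes of this relation.\<close>

definition ideal_eq :: "('o, 'm, 'x) addcat_scheme \<Rightarrow> 'o set \<Rightarrow> 'm \<Rightarrow> 'm \<Rightarrow> bool" where
  "ideal_eq C \<I> f g \<longleftrightarrow> (\<exists>X\<in>Obj C. \<exists>Y\<in>Obj C. f \<in> Hom C X Y \<and> g \<in> Hom C X Y \<and>
     (\<exists>K\<in>\<I>. \<exists>a\<in>Hom C X K. \<exists>b\<in>Hom C K Y. g = f \<oplus>\<^bsub>C\<^esub> (b \<cdot>\<^bsub>C\<^esub> a)))"

definition ideal_class :: "('o, 'm, 'x) addcat_scheme \<Rightarrow> 'o set \<Rightarrow> 'm \<Rightarrow> 'm set" where
  "ideal_class C \<I> f = {g. ideal_eq C \<I> f g}"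

definition ideal_quotient ::
  "('o, 'm, 'x) addcat_scheme \<Rightarrow> 'o set \<Rightarrow> 'o set \<Rightarrow> ('o, 'm set) addcat" where
  "ideal_quotient C \<X> \<I> =
     \<lparr>Obj = \<X>,
      Hom = (\<lambda>X Y. ideal_class C \<I> ` Hom C X Y),
      Idn = (\<lambda>X. ideal_class C \<I> (Idn C X)),
      Cmp = (\<lambda>\<beta> \<alpha>. \<Union>g\<in>\<beta>. \<Union>f\<in>\<alpha>. ideal_class C \<I> (g \<cdot>\<^bsub>C\<^esub> f)),
      Add = (\<lambda>\<alpha> \<beta>. \<Union>f\<in>\<alpha>. \<Union>g\<in>\<beta>. ideal_class C \<I> (f \<oplus>\<^bsub>C\<^esub> g)),
      Zero = (\<lambda>X Y. ideal_class C \<I> (Zero C X Y))\<rparr>"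


section \<open>Triangulated categories\<close>

text \<open>The shift \<open>[1]\<close> is a strict automorphism, given by \<^term>\<open>ShO\<close> on objects and \<^term>\<open>ShM\<close> on morphisms.\<close>

record ('o, 'm) tricat = "('o, 'm) addcat" +
  ShO :: "'o \<Rightarrow> 'o"
  ShM :: "'m \<Rightarrow> 'm"
  Tri :: "('m \<times> 'm \<times> 'm) set"

definition candidate ::
  "('o, 'm, 'x) tricat_scheme \<Rightarrow> 'o \<Rightarrow> 'o \<Rightarrow> 'o \<Rightarrow> 'm \<Rightarrow> 'm \<Rightarrow> 'm \<Rightarrow> bool" where
  "candidate C X Y Z f g h \<longleftrightarrow> X \<in> Obj C \<and> Y \<in> Obj C \<and> Z \<in> Obj C \<and>
     f \<in> Hom C X Y \<and> g \<in> Hom C Y Z \<and> h \<in> Hom C Z (ShO C X)"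

definition tri ::
  "('o, 'm, 'x) tricat_scheme \<Rightarrow> 'o \<Rightarrow> 'o \<Rightarrow> 'o \<Rightarrow> 'm \<Rightarrow> 'm \<Rightarrow> 'm \<Rightarrow> bool" where
  "tri C X Y Z f g h \<longleftrightarrow> candidate C X Y Z f g h \<and> (f, g, h) \<in> Tri C"

text \<open>The triple \<open>(p, q, r)\<close> commutes with the candidate triangles \<open>(f, g, h)\<close> and \<open>(f', g', h')\<close>.\<close>

definition tri_commute ::
  "('o, 'm, 'x) tricat_scheme \<Rightarrow> 'm \<Rightarrow> 'm \<Rightarrow> 'm \<Rightarrow> 'm \<Rightarrow> 'm \<Rightarrow> 'm \<Rightarrow> 'm \<Rightarrow> 'm \<Rightarrow> 'm \<Rightarrow> bool" where
  "tri_commute C f g h f' g' h' p q r \<longleftrightarrow>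
     q \<cdot>\<^bsub>C\<^esub> f = f' \<cdot>\<^bsub>C\<^esub> p \<and> r \<cdot>\<^bsub>C\<^esub> g = g' \<cdot>\<^bsub>C\<^esub> q \<and> ShM C p \<cdot>\<^bsub>C\<^esub> h = h' \<cdot>\<^bsub>C\<^esub> r"

locale triangulated_category = additive_category C
  for C :: "('o, 'm, 'x) tricat_scheme" (structure) +
  assumes ShO_bij: "bij_betw (ShO C) (Obj C) (Obj C)"
    and ShM_bij:
      "\<lbrakk>X \<in> Obj C; Y \<in> Obj C\<rbrakk> \<Longrightarrow> bij_betw (ShM C) (Hom C X Y) (Hom C (ShO C X) (ShO C Y))"
    and ShM_Idn: "X \<in> Obj C \<Longrightarrow> ShM C (Idn C X) = Idn C (ShO C X)"
    and ShM_Cmp: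
      "\<lbrakk>X \<in> Obj C; Y \<in> Obj C; Z \<in> Obj C; f \<in> Hom C X Y; g \<in> Hom C Y Z\<rbrakk>
        \<Longrightarrow> ShM C (g \<cdot> f) = ShM C g \<cdot> ShM C f"
    and ShM_Add:
      "\<lbrakk>X \<in> Obj C; Y \<in> Obj C; f \<in> Hom C X Y; g \<in> Hom C X Y\<rbrakk>
        \<Longrightarrow> ShM C (f \<oplus> g) = ShM C f \<oplus> ShM C g"
    and tri_iso:
      "\<lbrakk>tri C X Y Z f g h; candidate C X' Y' Z' f' g' h';
        iso_arr C X X' p; iso_arr C Y Y' q; iso_arr C Z Z' r;
        tri_commute C f g h f' g' h' p q r\<rbrakk> \<Longrightarrow> tri C X' Y' Z' f' g' h'"
    and tri_Idn:
      "\<lbrakk>X \<in> Obj C; zero_obj C Z\<rbrakk>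
        \<Longrightarrow> tri C X X Z (Idn C X) (Zero C X Z) (Zero C Z (ShO C X))"
    and tri_complete:
      "\<lbrakk>X \<in> Obj C; Y \<in> Obj C; f \<in> Hom C X Y\<rbrakk> \<Longrightarrow> \<exists>Z g h. tri C X Y Z f g h"
    and tri_rotate:
      "candidate C X Y Z f g h
        \<Longrightarrow> tri C X Y Z f g h \<longleftrightarrow> tri C Y Z (ShO C X) g h (Neg C (ShO C X) (ShO C Y) (ShM C f))"
    and tri_morphism:
      "\<lbrakk>tri C X Y Z f g h; tri C X' Y' Z' f' g' h'; p \<in> Hom C X X'; q \<in> Hom C Y Y';
        q \<cdot> f = f' \<cdot> p\<rbrakk> \<Longrightarrow> \<exists>r\<in>Hom C Z Z'. tri_commute C f g h f' g' h' p q r"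
    and octahedral:
      "\<lbrakk>tri C X Y Z' f a b; tri C Y Z X' g e k; tri C X Z Y' (g \<cdot> f) c d\<rbrakk>
        \<Longrightarrow> \<exists>u v. tri C Z' Y' X' u v (ShM C a \<cdot> k) \<and>
              u \<cdot> a = c \<cdot> g \<and> d \<cdot> u = b \<and> v \<cdot> c = e \<and> k \<cdot> v = ShM C f \<cdot> d"

text \<open>A triangle functor is an additive functor together with a natural isomorphism
  \<open>\<phi> : F [1] \<Rightarrow> [1] F\<close>; only the existence of \<open>\<phi>\<close> is recorded.\<close>

definition triangle_functor ::
  "('o, 'm, 'x) tricat_scheme \<Rightarrow> ('p, 'n, 'y) tricat_scheme \<Rightarrow> ('o, 'm, 'p, 'n) fctr \<Rightarrow> bool" where
  "triangle_functor A B F \<longleftrightarrow>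
     triangulated_category A \<and> triangulated_category B \<and> additive_functor A B F \<and>
     (\<exists>\<phi>. (\<forall>X\<in>Obj A. iso_arr B (FO F (ShO A X)) (ShO B (FO F X)) (\<phi> X)) \<and>
          (\<forall>X\<in>Obj A. \<forall>Y\<in>Obj A. \<forall>f\<in>Hom A X Y.
             \<phi> Y \<cdot>\<^bsub>B\<^esub> FM F (ShM A f) = ShM B (FM F f) \<cdot>\<^bsub>B\<^esub> \<phi> X) \<and>
          (\<forall>X Y Z f g h. tri A X Y Z f g h \<longrightarrow>
             tri B (FO F X) (FO F Y) (FO F Z) (FM F f) (FM F g) (\<phi> X \<cdot>\<^bsub>B\<^esub> FM F h)))"

definition triangulated_subcategory :: "('o, 'm, 'x) tricat_scheme \<Rightarrow> 'o set \<Rightarrow> bool" where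
  "triangulated_subcategory C \<N> \<longleftrightarrow> \<N> \<subseteq> Obj C \<and> iso_closed C \<N> \<and> (\<exists>X\<in>\<N>. zero_obj C X) \<and>
     (\<forall>X\<in>Obj C. X \<in> \<N> \<longleftrightarrow> ShO C X \<in> \<N>) \<and>
     (\<forall>X Y Z f g h. tri C X Y Z f g h \<longrightarrow> X \<in> \<N> \<longrightarrow> Y \<in> \<N> \<longrightarrow> Z \<in> \<N>)"

definition shift :: "('o, 'm, 'x) tricat_scheme \<Rightarrow> 'o set \<Rightarrow> 'o set" where
  "shift C A = ShO C ` A"

definition unshift :: "('o, 'm, 'x) tricat_scheme \<Rightarrow> 'o set \<Rightarrow> 'o set" where
  "unshift C A = {X \<in> Obj C. ShO C X \<in> A}"

definition star :: "('o, 'm, 'x) tricat_scheme \<Rightarrow> 'o set \<Rightarrow> 'o set \<Rightarrow> 'o set" where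
  "star C \<X> \<Y> = {K \<in> Obj C. \<exists>X\<in>\<X>. \<exists>Y\<in>\<Y>. \<exists>f g h. tri C X K Y f g h}"

definition right_perp :: "('o, 'm, 'x) addcat_scheme \<Rightarrow> 'o set \<Rightarrow> 'o set" where
  "right_perp C \<X> = {K \<in> Obj C. \<forall>X\<in>\<X>. hom_zero C X K}"

definition left_perp :: "('o, 'm, 'x) addcat_scheme \<Rightarrow> 'o set \<Rightarrow> 'o set" where
  "left_perp C \<Y> = {K \<in> Obj C. \<forall>Y\<in>\<Y>. hom_zero C K Y}"

text \<open>Vanishing of \<open>Ext\<^sup>1(X, Y) = C(X, Y[1])\<close>.\<close>

definition ext1_zero :: "('o, 'm, 'x) tricat_scheme \<Rightarrow> 'o set \<Rightarrow> 'o set \<Rightarrow> bool" where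
  "ext1_zero C \<X> \<Y> \<longleftrightarrow> (\<forall>X\<in>\<X>. \<forall>Y\<in>\<Y>. hom_zero C X (ShO C Y))"

definition cotorsion_pairs :: "('o, 'm, 'x) tricat_scheme \<Rightarrow> ('o set \<times> 'o set) set" where
  "cotorsion_pairs C = {(\<U>, \<V>). add_summand_closed C \<U> \<and> add_summand_closed C \<V> \<and>
     Obj C = star C \<U> (shift C \<V>) \<and> ext1_zero C \<U> \<V>}"


section \<open>Verdier quotients\<close>

text \<open>The Verdier quotient is constructed by calculus of fractions. A morphism \<open>X \<rightarrow> Y\<close> is a
  class of roofs \<open>(s, f)\<close> with \<open>s : W \<rightarrow> X\<close>, \<open>f : W \<rightarrow> Y\<close>, where the cone of \<open>s\<close> lies in \<open>\<N>\<close>.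
  An operation on classes is the union of the classes obtained from representatives.\<close>

definition cone_in :: "('o, 'm, 'x) tricat_scheme \<Rightarrow> 'o set \<Rightarrow> 'm set" where
  "cone_in C \<N> = {s. \<exists>X Y Z g h. Z \<in> \<N> \<and> tri C X Y Z s g h}"

definition roofs :: "('o, 'm, 'x) tricat_scheme \<Rightarrow> 'o set \<Rightarrow> 'o \<Rightarrow> 'o \<Rightarrow> ('m \<times> 'm) set" where
  "roofs C \<N> X Y = {(s, f). \<exists>W\<in>Obj C. s \<in> Hom C W X \<and> f \<in> Hom C W Y \<and> s \<in> cone_in C \<N>}"

definition roof_eq :: "('o, 'm, 'x) tricat_scheme \<Rightarrow> 'o set \<Rightarrow> 'm \<times> 'm \<Rightarrow> 'm \<times> 'm \<Rightarrow> bool" where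
  "roof_eq C \<N> = (\<lambda>(s, f) (s', f'). \<exists>X\<in>Obj C. \<exists>Y\<in>Obj C. \<exists>W\<in>Obj C. \<exists>W'\<in>Obj C. \<exists>K\<in>Obj C.
     s \<in> Hom C W X \<and> f \<in> Hom C W Y \<and> s \<in> cone_in C \<N> \<and>
     s' \<in> Hom C W' X \<and> f' \<in> Hom C W' Y \<and> s' \<in> cone_in C \<N> \<and>
     (\<exists>u\<in>Hom C K W. \<exists>u'\<in>Hom C K W'.
        s \<cdot>\<^bsub>C\<^esub> u = s' \<cdot>\<^bsub>C\<^esub> u' \<and> f \<cdot>\<^bsub>C\<^esub> u = f' \<cdot>\<^bsub>C\<^esub> u' \<and> s \<cdot>\<^bsub>C\<^esub> u \<in> cone_in C \<N>))"

definition roof_class :: "('o, 'm, 'x) tricat_scheme \<Rightarrow> 'o set \<Rightarrow> 'm \<times> 'm \<Rightarrow> ('m \<times> 'm) set" where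
  "roof_class C \<N> \<rho> = {\<rho>'. roof_eq C \<N> \<rho> \<rho>'}"

text \<open>The roof \<open>(s \<cdot> t', g \<cdot> f')\<close> represents \<open>(t, g) \<circ> (s, f)\<close> whenever \<open>t \<cdot> f' = f \<cdot> t'\<close>
  and the cone of \<open>t'\<close> lies in \<open>\<N>\<close>.\<close>

definition roof_comp ::
  "('o, 'm, 'x) tricat_scheme \<Rightarrow> 'o set \<Rightarrow> 'm \<times> 'm \<Rightarrow> 'm \<times> 'm \<Rightarrow> ('m \<times> 'm) set" where
  "roof_comp C \<N> = (\<lambda>(t, g) (s, f). {(s \<cdot>\<^bsub>C\<^esub> t', g \<cdot>\<^bsub>C\<^esub> f') | t' f'.
     \<exists>W\<in>Obj C. \<exists>W'\<in>Obj C. \<exists>K\<in>Obj C. \<exists>X\<in>Obj C. \<exists>Y\<in>Obj C. \<exists>Z\<in>Obj C.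
       s \<in> Hom C W X \<and> f \<in> Hom C W Y \<and> t \<in> Hom C W' Y \<and> g \<in> Hom C W' Z \<and>
       t' \<in> Hom C K W \<and> f' \<in> Hom C K W' \<and> t' \<in> cone_in C \<N> \<and> t \<cdot>\<^bsub>C\<^esub> f' = f \<cdot>\<^bsub>C\<^esub> t'})"

definition verdier_additive ::
  "('o, 'm, 'x) tricat_scheme \<Rightarrow> 'o set \<Rightarrow> ('o, ('m \<times> 'm) set) addcat" where
  "verdier_additive C \<N> =
     \<lparr>Obj = Obj C,
      Hom = (\<lambda>X Y. roof_class C \<N> ` roofs C \<N> X Y),
      Idn = (\<lambda>X. roof_class C \<N> (Idn C X, Idn C X)),
      Cmp = (\<lambda>\<beta> \<alpha>. \<Union>\<sigma>\<in>\<beta>. \<Union>\<rho>\<in>\<alpha>. \<Union>\<tau>\<in>roof_comp C \<N> \<sigma> \<rho>. roof_class C \<N> \<tau>),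
      Add = (\<lambda>\<alpha> \<beta>. \<Union>{roof_class C \<N> (s, f \<oplus>\<^bsub>C\<^esub> g) | s f g. (s, f) \<in> \<alpha> \<and> (s, g) \<in> \<beta>}),
      Zero = (\<lambda>X Y. roof_class C \<N> (Idn C X, Zero C X Y))\<rparr>"

text \<open>For \<open>f : X \<rightarrow> Y\<close> the source identity in the roof \<open>(1\<^sub>X, f)\<close> needs \<open>X\<close>, which \<open>f\<close> determines.\<close>

definition verdier_fctr ::
  "('o, 'm, 'x) tricat_scheme \<Rightarrow> 'o set \<Rightarrow> ('o, 'm, 'o, ('m \<times> 'm) set) fctr" where
  "verdier_fctr C \<N> =
     \<lparr>FO = (\<lambda>X. X),
      FM = (\<lambda>f. \<Union>{roof_class C \<N> (Idn C X, f) | X Y. X \<in> Obj C \<and> Y \<in> Obj C \<and> f \<in> Hom C X Y})\<rparr>"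

definition verdier_shift ::
  "('o, 'm, 'x) tricat_scheme \<Rightarrow> 'o set \<Rightarrow> ('m \<times> 'm) set \<Rightarrow> ('m \<times> 'm) set" where
  "verdier_shift C \<N> \<alpha> = (\<Union>(s, f)\<in>\<alpha>. roof_class C \<N> (ShM C s, ShM C f))"

text \<open>The distinguished triangles are those isomorphic to images of distinguished triangles.\<close>

definition verdier_tri ::
  "('o, 'm, 'x) tricat_scheme \<Rightarrow> 'o set
     \<Rightarrow> (('m \<times> 'm) set \<times> ('m \<times> 'm) set \<times> ('m \<times> 'm) set) set" where
  "verdier_tri C \<N> = (let D = verdier_additive C \<N>; L = FM (verdier_fctr C \<N>) in
     {(\<alpha>, \<beta>, \<gamma>). \<exists>X\<in>Obj C. \<exists>Y\<in>Obj C. \<exists>Z\<in>Obj C. \<exists>X' Y' Z' f g h p q r.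
        \<alpha> \<in> Hom D X Y \<and> \<beta> \<in> Hom D Y Z \<and> \<gamma> \<in> Hom D Z (ShO C X) \<and> tri C X' Y' Z' f g h \<and>
        iso_arr D X X' p \<and> iso_arr D Y Y' q \<and> iso_arr D Z Z' r \<and>
        q \<cdot>\<^bsub>D\<^esub> \<alpha> = L f \<cdot>\<^bsub>D\<^esub> p \<and> r \<cdot>\<^bsub>D\<^esub> \<beta> = L g \<cdot>\<^bsub>D\<^esub> q \<and>
        verdier_shift C \<N> p \<cdot>\<^bsub>D\<^esub> \<gamma> = L h \<cdot>\<^bsub>D\<^esub> r})"

definition verdier ::
  "('o, 'm, 'x) tricat_scheme \<Rightarrow> 'o set \<Rightarrow> ('o, ('m \<times> 'm) set) tricat" where
  "verdier C \<N> = addcat.extend (verdier_additive C \<N>)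
     \<lparr>ShO = ShO C, ShM = verdier_shift C \<N>, Tri = verdier_tri C \<N>\<rparr>"


section \<open>Recollements\<close>

text \<open>The quotient is not an extra datum: it is \<^term>\<open>verdier C \<N>\<close> with the functor \<^term>\<open>verdier_fctr C \<N>\<close>.\<close>

definition recollement ::
  "('o, 'm, 'x) tricat_scheme \<Rightarrow> 'o set \<Rightarrow> ('o, 'm, 'o, 'm) fctr \<Rightarrow> ('o, 'm, 'o, 'm) fctr
     \<Rightarrow> ('o, ('m \<times> 'm) set, 'o, 'm) fctr \<Rightarrow> ('o, ('m \<times> 'm) set, 'o, 'm) fctr \<Rightarrow> bool" where
  "recollement C \<N> i_star i_shriek j_shriek j_star \<longleftrightarrow>
     (let N = full_sub C \<N>; D = verdier C \<N>; i = incl_fctr; l = verdier_fctr C \<N> in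
      triangulated_category C \<and> triangulated_subcategory C \<N> \<and>
      triangle_functor N C i \<and> triangle_functor C N i_star \<and> triangle_functor C N i_shriek \<and>
      triangle_functor C D l \<and> triangle_functor D C j_shriek \<and> triangle_functor D C j_star \<and>
      fully_faithful N C i \<and> fully_faithful D C j_shriek \<and> fully_faithful D C j_star \<and>
      (\<forall>X\<in>\<N>. zero_obj D (FO l (FO i X))) \<and>
      (\<exists>\<eta> \<epsilon> \<eta>' \<epsilon>' \<theta> \<delta> \<theta>' \<delta>'.
         adjunction C N i_star i \<eta> \<epsilon> \<and> adjunction N C i i_shriek \<eta>' \<epsilon>' \<and>
         adjunction D C j_shriek l \<theta> \<delta> \<and> adjunction C D l j_star \<theta>' \<delta>' \<and>
         (\<forall>X\<in>Obj C.
            (\<exists>h. tri C (FO i (FO i_shriek X)) X (FO j_star (FO l X)) (\<epsilon>' X) (\<theta>' X) h) \<and>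
            (\<exists>h. tri C (FO j_shriek (FO l X)) X (FO i (FO i_star X)) (\<delta> X) (\<eta> X) h))))"


section \<open>Twin cotorsion pairs\<close>

type_synonym 'o tcp = "('o set \<times> 'o set) \<times> ('o set \<times> 'o set)"

fun tcp_I :: "'o tcp \<Rightarrow> 'o set" where
  "tcp_I ((\<S>, \<T>), (\<U>, \<V>)) = \<S> \<inter> \<T>"

fun tcp_Z :: "'o tcp \<Rightarrow> 'o set" where
  "tcp_Z ((\<S>, \<T>), (\<U>, \<V>)) = \<T> \<inter> \<U>"

text \<open>Over a recollement, and for a cotorsion pair \<open>(\<S>, \<V>)\<close> on \<open>\<N>\<close>, this is a Hovey twin cotorsion
  pair on \<open>C\<close>; in particular \<open>\<S> \<inter> \<T> = \<U> \<inter> \<V>\<close>.\<close>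

definition associated_tcp ::
  "('o, 'm, 'x) tricat_scheme \<Rightarrow> ('o, 'm, 'o, 'm) fctr \<Rightarrow> ('o, 'm, 'o, 'm) fctr
     \<Rightarrow> 'o set \<Rightarrow> 'o set \<Rightarrow> 'o tcp" where
  "associated_tcp C i_star i_shriek \<S> \<V> =
     ((\<S>, preimage C i_shriek \<V>), (preimage C i_star \<S>, \<V>))"

text \<open>The functors \<open>\<sigma>\<close>, \<open>\<omega>\<close> and \<open>\<langle>1\<rangle>\<close> depend on choices (of adjoints and of triangles); the following
  predicates say that a given functor arises from some such choice.\<close>

fun is_sigma :: "('o, 'm, 'x) tricat_scheme \<Rightarrow> 'o tcp \<Rightarrow> ('o, 'm set, 'o, 'm set) fctr \<Rightarrow> bool" where
  "is_sigma C ((\<S>, \<T>), (\<U>, \<V>)) \<sigma> \<longleftrightarrow>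
     (let \<I> = tcp_I ((\<S>, \<T>), (\<U>, \<V>)); \<Z> = tcp_Z ((\<S>, \<T>), (\<U>, \<V>)) in
      (\<exists>\<eta> \<epsilon>. adjunction (ideal_quotient C \<U> \<I>) (ideal_quotient C \<Z> \<I>) \<sigma> incl_fctr \<eta> \<epsilon>) \<and>
      (\<forall>X\<in>\<U>. \<exists>R\<in>unshift C \<S>. \<exists>a b c. tri C R X (FO \<sigma> X) a b c))"

fun is_omega :: "('o, 'm, 'x) tricat_scheme \<Rightarrow> 'o tcp \<Rightarrow> ('o, 'm set, 'o, 'm set) fctr \<Rightarrow> bool" where
  "is_omega C ((\<S>, \<T>), (\<U>, \<V>)) \<omega> \<longleftrightarrow>
     (let \<I> = tcp_I ((\<S>, \<T>), (\<U>, \<V>)); \<Z> = tcp_Z ((\<S>, \<T>), (\<U>, \<V>)) in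
      (\<exists>\<eta> \<epsilon>. adjunction (ideal_quotient C \<Z> \<I>) (ideal_quotient C \<T> \<I>) incl_fctr \<omega> \<eta> \<epsilon>) \<and>
      (\<forall>X\<in>\<T>. \<exists>V\<in>\<V>. \<exists>a b c. tri C V (FO \<omega> X) X a b c))"

fun is_angle :: "('o, 'm, 'x) tricat_scheme \<Rightarrow> 'o tcp \<Rightarrow> ('o, 'm set, 'o, 'm set) fctr \<Rightarrow> bool" where
  "is_angle C ((\<S>, \<T>), (\<U>, \<V>)) \<Theta> \<longleftrightarrow>
     (let \<I> = tcp_I ((\<S>, \<T>), (\<U>, \<V>)); \<Z> = tcp_Z ((\<S>, \<T>), (\<U>, \<V>)) in
      cat_functor (ideal_quotient C \<Z> \<I>) (ideal_quotient C \<U> \<I>) \<Theta> \<and>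
      (\<exists>J a b c.
         (\<forall>X\<in>\<Z>. J X \<in> \<I> \<and> FO \<Theta> X \<in> \<U> \<and> tri C X (J X) (FO \<Theta> X) (a X) (b X) (c X)) \<and>
         (\<forall>X\<in>\<Z>. \<forall>Y\<in>\<Z>. \<forall>z\<in>Hom C X Y. \<forall>j\<in>Hom C (J X) (J Y). \<forall>u\<in>Hom C (FO \<Theta> X) (FO \<Theta> Y).
            tri_commute C (a X) (b X) (c X) (a Y) (b Y) (c Y) z j u \<longrightarrow>
            FM \<Theta> (ideal_class C \<I> z) = ideal_class C \<I> u)))"

text \<open>Vanishing of \<open>Ext\<^sup>1(X, Y) = (\<Z>/\<I>)(X, \<Sigma> Y)\<close> in \<open>\<Z>/\<I>\<close>, where \<open>\<Sigma> = \<sigma> \<circ> \<langle>1\<rangle>\<close>.\<close>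

definition ext1_ZI_zero ::
  "('o, 'm, 'x) tricat_scheme \<Rightarrow> 'o tcp \<Rightarrow> ('o, 'm set, 'o, 'm set) fctr
     \<Rightarrow> ('o, 'm set, 'o, 'm set) fctr \<Rightarrow> 'o set \<Rightarrow> 'o set \<Rightarrow> bool" where
  "ext1_ZI_zero C P \<sigma> \<Theta> \<X> \<Y> \<longleftrightarrow>
     (\<forall>X\<in>\<X>. \<forall>Y\<in>\<Y>.
        hom_zero (ideal_quotient C (tcp_Z P) (tcp_I P)) X (FO (comp_fctr \<sigma> \<Theta>) Y))"

fun M_tcp ::
  "('o, 'm, 'x) tricat_scheme \<Rightarrow> 'o tcp \<Rightarrow> ('o, 'm set, 'o, 'm set) fctr
     \<Rightarrow> ('o, 'm set, 'o, 'm set) fctr \<Rightarrow> ('o, 'm set, 'o, 'm set) fctr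
     \<Rightarrow> ('o set \<times> 'o set) set" where
  "M_tcp C ((\<S>, \<T>), (\<U>, \<V>)) \<sigma> \<omega> \<Theta> =
     {(\<A>, \<B>) \<in> cotorsion_pairs C. \<S> \<subseteq> \<A> \<and> \<A> \<subseteq> \<U> \<and> \<V> \<subseteq> \<B> \<and> \<B> \<subseteq> \<T> \<and>
        ext1_ZI_zero C ((\<S>, \<T>), (\<U>, \<V>)) \<sigma> \<Theta> (FO \<sigma> ` \<A>) (FO \<omega> ` \<B>)}"

definition M_pair ::
  "('o, 'm, 'x) tricat_scheme \<Rightarrow> 'o set \<Rightarrow> 'o set \<Rightarrow> 'o set \<Rightarrow> ('o set \<times> 'o set) set" where
  "M_pair C \<N> \<S> \<V> =
     {(\<A>, \<B>) \<in> cotorsion_pairs C.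
        \<S> \<subseteq> \<A> \<and> \<A> \<subseteq> left_perp C (shift C \<V>) \<and> \<V> \<subseteq> \<B> \<and> \<B> \<subseteq> right_perp C (unshift C \<S>) \<and>
        ext1_zero (verdier C \<N>)
          (ess_image (verdier C \<N>) (verdier_fctr C \<N>) \<A>)
          (ess_image (verdier C \<N>) (verdier_fctr C \<N>) \<B>)}"

text \<open>A map between classes is a function made \<^const>\<open>undefined\<close> outside its domain by \<^const>\<open>restrict\<close>.\<close>

definition R_tcp ::
  "('o, 'm, 'x) tricat_scheme \<Rightarrow> 'o set \<Rightarrow> 'o tcp \<Rightarrow> ('o, 'm set, 'o, 'm set) fctr
     \<Rightarrow> ('o, 'm set, 'o, 'm set) fctr \<Rightarrow> ('o, 'm set, 'o, 'm set) fctr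
     \<Rightarrow> 'o set \<times> 'o set \<Rightarrow> 'o set \<times> 'o set" where
  "R_tcp C \<N> P \<sigma> \<omega> \<Theta> =
     restrict (\<lambda>(\<A>, \<B>). (ess_image (verdier C \<N>) (verdier_fctr C \<N>) \<A>,
                         ess_image (verdier C \<N>) (verdier_fctr C \<N>) \<B>))
       (M_tcp C P \<sigma> \<omega> \<Theta>)"

fun I_tcp ::
  "('o, 'm, 'x) tricat_scheme \<Rightarrow> 'o set \<Rightarrow> 'o tcp \<Rightarrow> 'o set \<times> 'o set \<Rightarrow> 'o set \<times> 'o set" where
  "I_tcp C \<N> ((\<S>, \<T>), (\<U>, \<V>)) =
     restrict (\<lambda>(\<E>, \<F>). (\<U> \<inter> preimage C (verdier_fctr C \<N>) \<E>,
                         \<T> \<inter> preimage C (verdier_fctr C \<N>) \<F>))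
       (cotorsion_pairs (verdier C \<N>))"

definition R_pair ::
  "('o, 'm, 'x) tricat_scheme \<Rightarrow> 'o set \<Rightarrow> 'o set \<Rightarrow> 'o set
     \<Rightarrow> 'o set \<times> 'o set \<Rightarrow> 'o set \<times> 'o set" where
  "R_pair C \<N> \<S> \<V> =
     restrict (\<lambda>(\<A>, \<B>). (ess_image (verdier C \<N>) (verdier_fctr C \<N>) \<A>,
                         ess_image (verdier C \<N>) (verdier_fctr C \<N>) \<B>))
       (M_pair C \<N> \<S> \<V>)"

definition I_pair ::
  "('o, 'm, 'x) tricat_scheme \<Rightarrow> 'o set \<Rightarrow> ('o, 'm, 'o, 'm) fctr \<Rightarrow> ('o, 'm, 'o, 'm) fctr
     \<Rightarrow> 'o set \<Rightarrow> 'o set \<Rightarrow> 'o set \<times> 'o set \<Rightarrow> 'o set \<times> 'o set" where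
  "I_pair C \<N> i_star i_shriek \<S> \<V> =
     restrict (\<lambda>(\<E>, \<F>). (preimage C i_star \<S> \<inter> preimage C (verdier_fctr C \<N>) \<E>,
                         preimage C i_shriek \<V> \<inter> preimage C (verdier_fctr C \<N>) \<F>))
       (cotorsion_pairs (verdier C \<N>))"

end

theory Submission
  imports Defs
begin

text \<open>Write \<open>D\<close> for the Verdier quotient \<open>C/\<N>\<close>. The maps \<open>I\<close> agree by definition, and the maps \<open>R\<close> are given
  by one formula, so everything reduces to the equality of the two classes of cotorsion pairs. It
  has two parts.

  First, the bounds on \<open>\<A>\<close> and \<open>\<B>\<close> coincide: \<open>\<U>\<close> is the left perpendicular class of
  \<open>\<V>[1]\<close> and \<open>\<T>\<close> the right one of \<open>\<S>[-1]\<close>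
  (\<open>preimage_i_star_eq\<close>, \<open>preimage_i_shriek_eq\<close>). In a cotorsion pair each class is, up to
  a shift, the perpendicular of the other one, because a triangle with a zero map splits and the classes are closed under
  summands. Applied to \<open>(\<S>, \<V>)\<close> in \<open>\<N>\<close>, this describes \<open>i\<^sup>* X \<in> \<S>\<close> and \<open>i\<^sup>! X \<in> \<V>\<close> by vanishing of
  morphisms in \<open>\<N>\<close>, and the adjunctions move that vanishing to \<open>C\<close>.

  Second, the two \<open>Ext\<close> conditions are equivalent. The heart is \<open>l_hom_zero_iff\<close>: for \<open>X \<in> \<U>\<close> and
  \<open>W \<in> \<T>\<close>, \<open>D(X, W)\<close> vanishes exactly when every \<open>f : X \<rightarrow> W\<close> in \<open>C\<close> factors through the core
  \<open>\<S> \<inter> \<T>\<close>. Identify \<open>D(X, W)\<close> with \<open>C(X, j\<^sub>* W)\<close> and use the triangle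
  \<open>i\<^sup>! W \<rightarrow> W \<rightarrow> j\<^sub>* W \<rightarrow> (i\<^sup>! W)[1]\<close>: as \<open>i\<^sup>! W \<in> \<V>\<close>, every map \<open>X \<rightarrow> j\<^sub>* W\<close> lifts to \<open>W\<close>, and a map
  \<open>X \<rightarrow> W\<close> that dies in \<open>j\<^sub>* W\<close> factors through \<open>i\<^sup>! W\<close> and hence through the core
  (\<open>factors_through_core\<close>). All that this uses of the quotient
  functor is its right adjoint, its action on triangles, and that it kills \<open>\<N>\<close>.

  For \<open>A \<in> \<A>\<close> and \<open>B \<in> \<B>\<close>, the triangles that define \<open>\<sigma>\<close>, \<open>\<omega>\<close> and \<open>\<langle>1\<rangle>\<close> each have a vertex in \<open>\<N>\<close>,
  which becomes zero in \<open>D\<close>; so \<open>(\<sigma> A, \<sigma> ((\<omega> B)\<langle>1\<rangle>))\<close> and \<open>(A, B[1])\<close> have vanishing morphisms in \<open>D\<close>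
  at the same time (\<open>ext_vanishing_iff\<close>).\<close>


section \<open>Additive categories\<close>

context additive_category
begin

lemma Zero_in_Hom:
  assumes "X \<in> Obj C" "Y \<in> Obj C"
  shows "Zero C X Y \<in> Hom C X Y"
proof -
  interpret comm_group "hom_group C X Y" using assms hom_comm_group by blast
  show ?thesis using one_closed by (simp add: hom_group_def)
qed

lemma Add_in_Hom:
  "\<lbrakk>X \<in> Obj C; Y \<in> Obj C; f \<in> Hom C X Y; g \<in> Hom C X Y\<rbrakk> \<Longrightarrow> f \<oplus> g \<in> Hom C X Y"
proof -
  assume a: "X \<in> Obj C" "Y \<in> Obj C" "f \<in> Hom C X Y" "g \<in> Hom C X Y"
  interpret comm_group "hom_group C X Y" using a hom_comm_group by blast
  show ?thesis using m_closed[of f g] a by (simp add: hom_group_def)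
qed

lemma Neg_in_Hom:
  "\<lbrakk>X \<in> Obj C; Y \<in> Obj C; f \<in> Hom C X Y\<rbrakk> \<Longrightarrow> Neg C X Y f \<in> Hom C X Y"
proof -
  assume a: "X \<in> Obj C" "Y \<in> Obj C" "f \<in> Hom C X Y"
  interpret comm_group "hom_group C X Y" using a hom_comm_group by blast
  show ?thesis using inv_closed[of f] a by (simp add: hom_group_def Neg_def)
qed

lemma Add_assoc:
  "\<lbrakk>X \<in> Obj C; Y \<in> Obj C; f \<in> Hom C X Y; g \<in> Hom C X Y; h \<in> Hom C X Y\<rbrakk>
    \<Longrightarrow> (f \<oplus> g) \<oplus> h = f \<oplus> (g \<oplus> h)"
proof -
  assume a: "X \<in> Obj C" "Y \<in> Obj C" "f \<in> Hom C X Y" "g \<in> Hom C X Y" "h \<in> Hom C X Y"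
  interpret comm_group "hom_group C X Y" using a hom_comm_group by blast
  show ?thesis using m_assoc[of f g h] a by (simp add: hom_group_def)
qed

lemma Add_comm:
  "\<lbrakk>X \<in> Obj C; Y \<in> Obj C; f \<in> Hom C X Y; g \<in> Hom C X Y\<rbrakk> \<Longrightarrow> f \<oplus> g = g \<oplus> f"
proof -
  assume a: "X \<in> Obj C" "Y \<in> Obj C" "f \<in> Hom C X Y" "g \<in> Hom C X Y"
  interpret comm_group "hom_group C X Y" using a hom_comm_group by blast
  show ?thesis using m_comm[of f g] a by (simp add: hom_group_def)
qed

lemma Add_Zero:
  "\<lbrakk>X \<in> Obj C; Y \<in> Obj C; f \<in> Hom C X Y\<rbrakk> \<Longrightarrow> f \<oplus> Zero C X Y = f"
proof -
  assume a: "X \<in> Obj C" "Y \<in> Obj C" "f \<in> Hom C X Y"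
  interpret comm_group "hom_group C X Y" using a hom_comm_group by blast
  show ?thesis using r_one[of f] a by (simp add: hom_group_def)
qed

lemma Zero_Add:
  "\<lbrakk>X \<in> Obj C; Y \<in> Obj C; f \<in> Hom C X Y\<rbrakk> \<Longrightarrow> Zero C X Y \<oplus> f = f"
  using Add_Zero[of X Y f] Add_comm[of X Y f "Zero C X Y"] Zero_in_Hom[of X Y] by simp

lemma Add_Neg:
  "\<lbrakk>X \<in> Obj C; Y \<in> Obj C; f \<in> Hom C X Y\<rbrakk> \<Longrightarrow> f \<oplus> Neg C X Y f = Zero C X Y"
proof -
  assume a: "X \<in> Obj C" "Y \<in> Obj C" "f \<in> Hom C X Y"
  interpret comm_group "hom_group C X Y" using a hom_comm_group by blast
  show ?thesis using r_inv[of f] a by (simp add: hom_group_def Neg_def)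
qed

lemma Add_left_cancel:
  "\<lbrakk>X \<in> Obj C; Y \<in> Obj C; f \<in> Hom C X Y; g \<in> Hom C X Y; h \<in> Hom C X Y; f \<oplus> g = f \<oplus> h\<rbrakk>
    \<Longrightarrow> g = h"
proof -
  assume a: "X \<in> Obj C" "Y \<in> Obj C" "f \<in> Hom C X Y" "g \<in> Hom C X Y" "h \<in> Hom C X Y"
    "f \<oplus> g = f \<oplus> h"
  interpret comm_group "hom_group C X Y" using a hom_comm_group by blast
  show ?thesis using a Units_l_cancel[of f g h, unfolded Units_eq] by (simp add: hom_group_def)
qed

lemma idempotent_Zero:
  "\<lbrakk>X \<in> Obj C; Y \<in> Obj C; f \<in> Hom C X Y; f \<oplus> f = f\<rbrakk> \<Longrightarrow> f = Zero C X Y"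
  using Add_left_cancel[of X Y f f "Zero C X Y"] Add_Zero[of X Y f] Zero_in_Hom[of X Y] by simp

lemma Neg_unique:
  "\<lbrakk>X \<in> Obj C; Y \<in> Obj C; f \<in> Hom C X Y; g \<in> Hom C X Y; f \<oplus> g = Zero C X Y\<rbrakk>
    \<Longrightarrow> g = Neg C X Y f"
  using Add_left_cancel[of X Y f g "Neg C X Y f"] Add_Neg[of X Y f] Neg_in_Hom[of X Y f] by simp

lemma Neg_Neg:
  "\<lbrakk>X \<in> Obj C; Y \<in> Obj C; f \<in> Hom C X Y\<rbrakk> \<Longrightarrow> Neg C X Y (Neg C X Y f) = f"
  using Neg_unique[of X Y "Neg C X Y f" f] Add_Neg[of X Y f] Neg_in_Hom[of X Y f]
    Add_comm[of X Y f "Neg C X Y f"] by simp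

lemma Neg_Zero:
  "\<lbrakk>X \<in> Obj C; Y \<in> Obj C\<rbrakk> \<Longrightarrow> Neg C X Y (Zero C X Y) = Zero C X Y"
  using Neg_unique[of X Y "Zero C X Y" "Zero C X Y"] Add_Zero[of X Y "Zero C X Y"]
    Zero_in_Hom[of X Y] by simp

lemma diff_Zero_eq:
  "\<lbrakk>X \<in> Obj C; Y \<in> Obj C; f \<in> Hom C X Y; g \<in> Hom C X Y; f \<oplus> Neg C X Y g = Zero C X Y\<rbrakk>
    \<Longrightarrow> f = g"
  using Neg_unique[of X Y "Neg C X Y g" f] Add_comm[of X Y f "Neg C X Y g"]
    Neg_in_Hom[of X Y g] Neg_Neg[of X Y g] by simp

lemma Cmp_Zero:
  assumes "X \<in> Obj C" "Y \<in> Obj C" "Z \<in> Obj C" "g \<in> Hom C Y Z"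
  shows "g \<cdot> Zero C X Y = Zero C X Z"
proof (rule idempotent_Zero)
  show "(g \<cdot> Zero C X Y) \<oplus> (g \<cdot> Zero C X Y) = g \<cdot> Zero C X Y"
    using assms Cmp_Add_right[of X Y Z "Zero C X Y" "Zero C X Y" g] Add_Zero[of X Y "Zero C X Y"]
      Zero_in_Hom[of X Y] by simp
qed (use assms Cmp_in_Hom Zero_in_Hom in auto)

lemma Zero_Cmp:
  assumes "X \<in> Obj C" "Y \<in> Obj C" "Z \<in> Obj C" "f \<in> Hom C X Y"
  shows "Zero C Y Z \<cdot> f = Zero C X Z"
proof (rule idempotent_Zero)
  show "(Zero C Y Z \<cdot> f) \<oplus> (Zero C Y Z \<cdot> f) = Zero C Y Z \<cdot> f"
    using assms Cmp_Add_left[of X Y Z f "Zero C Y Z" "Zero C Y Z"] Add_Zero[of Y Z "Zero C Y Z"]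
      Zero_in_Hom[of Y Z] by simp
qed (use assms Cmp_in_Hom Zero_in_Hom in auto)

lemma Cmp_Neg:
  assumes "X \<in> Obj C" "Y \<in> Obj C" "Z \<in> Obj C" "f \<in> Hom C X Y" "g \<in> Hom C Y Z"
  shows "g \<cdot> Neg C X Y f = Neg C X Z (g \<cdot> f)"
  using assms
  by (intro Neg_unique) (auto simp: Cmp_in_Hom Neg_in_Hom Add_Neg Cmp_Zero simp flip: Cmp_Add_right)

lemma Neg_Cmp:
  assumes "X \<in> Obj C" "Y \<in> Obj C" "Z \<in> Obj C" "f \<in> Hom C X Y" "g \<in> Hom C Y Z"
  shows "Neg C Y Z g \<cdot> f = Neg C X Z (g \<cdot> f)"
  using assms
  by (intro Neg_unique) (auto simp: Cmp_in_Hom Neg_in_Hom Add_Neg Zero_Cmp simp flip: Cmp_Add_left)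

lemma hom_zeroI:
  assumes "X \<in> Obj C" "Y \<in> Obj C" "\<And>f. f \<in> Hom C X Y \<Longrightarrow> f = Zero C X Y"
  shows "hom_zero C X Y"
  using assms Zero_in_Hom by (auto simp: hom_zero_def)

lemma hom_zeroD: "\<lbrakk>hom_zero C X Y; f \<in> Hom C X Y\<rbrakk> \<Longrightarrow> f = Zero C X Y"
  by (auto simp: hom_zero_def)

lemma zero_obj_hom_zero_left:
  assumes "zero_obj C X" "Y \<in> Obj C"
  shows "hom_zero C X Y"
proof (rule hom_zeroI)
  show X: "X \<in> Obj C" using assms by (simp add: zero_obj_def)
  fix f assume f: "f \<in> Hom C X Y"
  have "f = f \<cdot> Zero C X X" using assms Cmp_Idn[of X Y f] f X by (simp add: zero_obj_def)
  then show "f = Zero C X Y" using X assms f Cmp_Zero by metis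
qed (fact assms)

lemma zero_obj_hom_zero_right:
  assumes "zero_obj C X" "Y \<in> Obj C"
  shows "hom_zero C Y X"
proof (rule hom_zeroI)
  show X: "X \<in> Obj C" using assms by (simp add: zero_obj_def)
  fix f assume f: "f \<in> Hom C Y X"
  have "f = Zero C X X \<cdot> f" using assms Idn_Cmp[of Y X f] f X by (simp add: zero_obj_def)
  then show "f = Zero C Y X" using X assms f Zero_Cmp by metis
qed (fact assms)

lemma Zero_unique_through:
  assumes "X \<in> Obj C" "Y \<in> Obj C" "zero_obj C K" "a \<in> Hom C X K" "b \<in> Hom C K Y"
  shows "b \<cdot> a = Zero C X Y"
proof -
  have K: "K \<in> Obj C" using assms by (simp add: zero_obj_def)
  then have "a = Zero C X K" using assms zero_obj_hom_zero_right hom_zeroD by blast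
  then show ?thesis using K assms Cmp_Zero by metis
qed

lemma direct_sum_commute: "direct_sum C X Y Z \<Longrightarrow> direct_sum C Y X Z"
  unfolding direct_sum_def using Add_comm Cmp_in_Hom by (smt (verit))

lemma hom_zero_iso:
  assumes o: "X \<in> Obj C" "X' \<in> Obj C" "Y \<in> Obj C" "Y' \<in> Obj C"
    and i: "isomorphic C X X'" "isomorphic C Y Y'" and z: "hom_zero C X Y"
  shows "hom_zero C X' Y'"
proof (rule hom_zeroI)
  fix f assume f: "f \<in> Hom C X' Y'"
  obtain a a' where a: "a \<in> Hom C X X'" "a' \<in> Hom C X' X" "a \<cdot> a' = Idn C X'"
    using i by (auto simp: isomorphic_def iso_arr_def)
  obtain b b' where b: "b \<in> Hom C Y Y'" "b' \<in> Hom C Y' Y" "b \<cdot> b' = Idn C Y'"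
    using i by (auto simp: isomorphic_def iso_arr_def)
  have "b' \<cdot> (f \<cdot> a) = Zero C X Y"
    using z a b f o by (intro hom_zeroD Cmp_in_Hom)
  then have "b \<cdot> (b' \<cdot> (f \<cdot> a)) \<cdot> a' = Zero C X' Y'"
    using a b o by (simp add: Cmp_Zero Zero_Cmp)
  moreover have "b \<cdot> (b' \<cdot> (f \<cdot> a)) = f \<cdot> a"
    using a b o f Cmp_assoc[of X Y' Y Y' "f \<cdot> a" b' b] by (simp add: Idn_Cmp Cmp_in_Hom)
  moreover have "f \<cdot> a \<cdot> a' = f"
    using a o f Cmp_assoc[of X' X X' Y' a' a f] by (simp add: Cmp_Idn)
  ultimately show "f = Zero C X' Y'" by simp
qed (use o in auto)

end

section \<open>Triangles and vanishing of morphisms\<close>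

context triangulated_category
begin

lemma ShO_in_Obj: "X \<in> Obj C \<Longrightarrow> ShO C X \<in> Obj C"
  using ShO_bij bij_betwE by blast

lemma ShM_in_Hom:
  "\<lbrakk>X \<in> Obj C; Y \<in> Obj C; f \<in> Hom C X Y\<rbrakk> \<Longrightarrow> ShM C f \<in> Hom C (ShO C X) (ShO C Y)"
  using ShM_bij bij_betwE by blast

lemma ShM_surj:
  assumes "X \<in> Obj C" "Y \<in> Obj C" "g \<in> Hom C (ShO C X) (ShO C Y)"
  obtains f where "f \<in> Hom C X Y" "ShM C f = g"
proof -
  have "g \<in> ShM C ` Hom C X Y" using ShM_bij[OF assms(1,2)] assms(3) by (simp add: bij_betw_def)
  then show ?thesis using that by blast
qed

lemma ShO_surj:
  assumes "Y \<in> Obj C"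
  obtains X where "X \<in> Obj C" "ShO C X = Y"
proof -
  have "Y \<in> ShO C ` Obj C" using ShO_bij assms by (simp add: bij_betw_def)
  then show ?thesis using that by blast
qed

lemma ShM_inj:
  "\<lbrakk>X \<in> Obj C; Y \<in> Obj C; f \<in> Hom C X Y; g \<in> Hom C X Y; ShM C f = ShM C g\<rbrakk> \<Longrightarrow> f = g"
  using ShM_bij by (meson bij_betw_def inj_on_def)

lemma ShM_Zero:
  assumes "X \<in> Obj C" "Y \<in> Obj C"
  shows "ShM C (Zero C X Y) = Zero C (ShO C X) (ShO C Y)"
proof (rule idempotent_Zero)
  show "ShM C (Zero C X Y) \<oplus> ShM C (Zero C X Y) = ShM C (Zero C X Y)"
    using assms ShM_Add[of X Y "Zero C X Y" "Zero C X Y"] Add_Zero[of X Y "Zero C X Y"]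
      Zero_in_Hom[of X Y] by simp
qed (use assms ShM_in_Hom ShO_in_Obj Zero_in_Hom in auto)

lemma zero_obj_ShO: "zero_obj C X \<Longrightarrow> zero_obj C (ShO C X)"
  using ShM_Zero[of X X] ShM_Idn[of X] ShO_in_Obj[of X] by (simp add: zero_obj_def)

lemma hom_zero_ShO_iff:
  assumes "X \<in> Obj C" "Y \<in> Obj C"
  shows "hom_zero C (ShO C X) (ShO C Y) \<longleftrightarrow> hom_zero C X Y"
proof
  assume z: "hom_zero C (ShO C X) (ShO C Y)"
  show "hom_zero C X Y"
  proof (rule hom_zeroI)
    fix f assume f: "f \<in> Hom C X Y"
    have "ShM C f = ShM C (Zero C X Y)"
      using hom_zeroD[OF z] ShM_in_Hom f assms ShM_Zero by simp
    then show "f = Zero C X Y" using ShM_inj f assms Zero_in_Hom by blast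
  qed (use assms in auto)
next
  assume z: "hom_zero C X Y"
  show "hom_zero C (ShO C X) (ShO C Y)"
  proof (rule hom_zeroI)
    fix g assume "g \<in> Hom C (ShO C X) (ShO C Y)"
    then obtain f where "f \<in> Hom C X Y" "ShM C f = g" using ShM_surj assms by blast
    then show "g = Zero C (ShO C X) (ShO C Y)" using hom_zeroD[OF z] assms ShM_Zero by auto
  qed (use assms ShO_in_Obj in auto)
qed

lemma isomorphic_ShO:
  assumes o: "X \<in> Obj C" "Y \<in> Obj C" and iso: "isomorphic C X Y"
  shows "isomorphic C (ShO C X) (ShO C Y)"
proof -
  obtain f g where fg: "f \<in> Hom C X Y" "g \<in> Hom C Y X" "g \<cdot> f = Idn C X" "f \<cdot> g = Idn C Y"
    using iso by (auto simp: isomorphic_def iso_arr_def)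
  have "iso_arr C (ShO C X) (ShO C Y) (ShM C f)"
    unfolding iso_arr_def
    using ShM_in_Hom[OF o fg(1)] ShM_in_Hom[OF o(2,1) fg(2)] ShM_Cmp[of X Y X f g]
      ShM_Cmp[of Y X Y g f] ShM_Idn o fg by auto
  then show ?thesis by (auto simp: isomorphic_def)
qed

lemma tri_D:
  assumes "tri C X Y Z f g h"
  shows "X \<in> Obj C" "Y \<in> Obj C" "Z \<in> Obj C"
    "f \<in> Hom C X Y" "g \<in> Hom C Y Z" "h \<in> Hom C Z (ShO C X)"
  using assms by (auto simp: tri_def candidate_def)

lemma tri_rotate_right:
  assumes "tri C X Y Z f g h"
  shows "tri C Y Z (ShO C X) g h (Neg C (ShO C X) (ShO C Y) (ShM C f))"
  using assms tri_rotate by (auto simp: tri_def)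

lemma tri_rotate_left:
  assumes t: "tri C X Y (ShO C V) f g h" and V: "V \<in> Obj C"
  obtains k where "tri C V X Y k f g"
proof -
  note o = tri_D[OF t]
  have "Neg C (ShO C V) (ShO C X) h \<in> Hom C (ShO C V) (ShO C X)"
    using o V ShO_in_Obj Neg_in_Hom by blast
  then obtain k where k: "k \<in> Hom C V X" "ShM C k = Neg C (ShO C V) (ShO C X) h"
    using ShM_surj V o by blast
  then have "Neg C (ShO C V) (ShO C X) (ShM C k) = h"
    using o V ShO_in_Obj Neg_Neg by simp
  moreover have "candidate C V X Y k f g" using o k V by (simp add: candidate_def)
  ultimately show ?thesis using that[of k] tri_rotate t by simp
qed

lemma tri_shift:
  assumes t: "tri C X Y Z f g h"
  obtains f' g' h' where "tri C (ShO C X) (ShO C Y) (ShO C Z) f' g' h'"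
  using tri_rotate_right[OF tri_rotate_right[OF tri_rotate_right[OF t]]] by blast

lemma tri_Cmp_Zero:
  assumes t: "tri C X Y Z f g h"
  shows "g \<cdot> f = Zero C X Z"
proof -
  note o = tri_D[OF t]
  obtain K where K: "zero_obj C K" using zero_obj_exists by blast
  obtain r where r: "r \<in> Hom C K Z" "r \<cdot> Zero C X K = g \<cdot> f"
    using tri_morphism[OF tri_Idn[OF o(1) K] t Idn_in_Hom[OF o(1)] o(4)] o
    by (auto simp: tri_commute_def)
  moreover have "K \<in> Obj C" using K by (simp add: zero_obj_def)
  ultimately show ?thesis using Cmp_Zero o by metis
qed

text \<open>Exactness of \<open>C(-, W)\<close> at the middle of a triangle: compare the triangle with one of the form
  \<open>0 \<rightarrow> W \<rightarrow> W \<rightarrow> 0\<close>.\<close>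

lemma tri_extend:
  assumes t: "tri C X Y Z f g h" and W: "W \<in> Obj C" and u: "u \<in> Hom C Y W"
    and uf: "u \<cdot> f = Zero C X W"
  obtains v where "v \<in> Hom C Z W" "u = v \<cdot> g"
proof -
  note o = tri_D[OF t]
  obtain K where K: "zero_obj C K" using zero_obj_exists by blast
  then have KO: "K \<in> Obj C" by (simp add: zero_obj_def)
  obtain k where k: "tri C K W W k (Idn C W) (Zero C W (ShO C K))"
    using tri_rotate_left[OF tri_Idn[OF W zero_obj_ShO[OF K]] KO] by blast
  have "u \<cdot> f = k \<cdot> Zero C X K" using uf o KO W tri_D[OF k] by (simp add: Cmp_Zero)
  then obtain r where "r \<in> Hom C Z W" "r \<cdot> g = Idn C W \<cdot> u"
    using tri_morphism[OF t k Zero_in_Hom[OF o(1) KO] u] by (auto simp: tri_commute_def)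
  then show ?thesis using that[of r] Idn_Cmp[OF o(2) W u] by simp
qed

text \<open>Exactness of \<open>C(W, -)\<close>: the axiom on morphisms of triangles produces only third maps, so the comparison is made
  with the rotated triangle \<open>W \<rightarrow> 0 \<rightarrow> W[1]\<close>, and the map \<open>W[1] \<rightarrow> X[1]\<close> obtained is then desuspended.\<close>

lemma tri_lift:
  assumes t: "tri C X Y Z f g h" and W: "W \<in> Obj C" and u: "u \<in> Hom C W Y"
    and gu: "g \<cdot> u = Zero C W Z"
  obtains v where "v \<in> Hom C W X" "u = f \<cdot> v"
proof -
  note o = tri_D[OF t]
  obtain K where K: "zero_obj C K" using zero_obj_exists by blast
  then have KO: "K \<in> Obj C" by (simp add: zero_obj_def)
  note S = ShO_in_Obj[OF W] ShO_in_Obj[OF o(1)] ShO_in_Obj[OF o(2)]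
  note t1 = tri_rotate_right[OF tri_Idn[OF W K]]
  note t2 = tri_rotate_right[OF t]
  have "Zero C K Z \<cdot> Zero C W K = g \<cdot> u" using gu W KO o by (simp add: Cmp_Zero Zero_in_Hom)
  then obtain r where r: "r \<in> Hom C (ShO C W) (ShO C X)"
    and e: "ShM C u \<cdot> Neg C (ShO C W) (ShO C W) (ShM C (Idn C W))
            = Neg C (ShO C X) (ShO C Y) (ShM C f) \<cdot> r"
    using tri_morphism[OF t1 t2 u Zero_in_Hom[OF KO o(3)]] by (auto simp: tri_commute_def)
  obtain v where v: "v \<in> Hom C W X" "ShM C v = r" using ShM_surj W o r by blast
  have "ShM C u \<cdot> Neg C (ShO C W) (ShO C W) (ShM C (Idn C W)) = Neg C (ShO C W) (ShO C Y) (ShM C u)"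
    using S W o u by (simp add: ShM_Idn Cmp_Neg Idn_in_Hom ShM_in_Hom Cmp_Idn)
  moreover have "Neg C (ShO C X) (ShO C Y) (ShM C f) \<cdot> r
      = Neg C (ShO C W) (ShO C Y) (ShM C (f \<cdot> v))"
    using S W o v r by (simp add: Neg_Cmp ShM_in_Hom ShM_Cmp)
  ultimately have "ShM C u = ShM C (f \<cdot> v)"
    using e S W o u v by (metis Neg_Neg ShM_in_Hom Cmp_in_Hom)
  then have "u = f \<cdot> v" using ShM_inj W o u v Cmp_in_Hom by metis
  then show ?thesis using that v by blast
qed

lemma tri_hom_zero_into:
  assumes t: "tri C X Y Z f g h" and W: "W \<in> Obj C" and z: "hom_zero C W X" "hom_zero C W Z"
  shows "hom_zero C W Y"
proof (rule hom_zeroI)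
  note o = tri_D[OF t]
  fix u assume u: "u \<in> Hom C W Y"
  then have "g \<cdot> u = Zero C W Z" using z o W Cmp_in_Hom hom_zeroD by blast
  then obtain v where "v \<in> Hom C W X" "u = f \<cdot> v" using tri_lift[OF t W u] by blast
  then show "u = Zero C W Y" using z o W hom_zeroD Cmp_Zero by metis
qed (use W tri_D[OF t] in auto)

lemma tri_hom_zero_from:
  assumes t: "tri C X Y Z f g h" and W: "W \<in> Obj C" and z: "hom_zero C X W" "hom_zero C Z W"
  shows "hom_zero C Y W"
proof (rule hom_zeroI)
  note o = tri_D[OF t]
  fix u assume u: "u \<in> Hom C Y W"
  then have "u \<cdot> f = Zero C X W" using z o W Cmp_in_Hom hom_zeroD by blast
  then obtain v where "v \<in> Hom C Z W" "u = v \<cdot> g" using tri_extend[OF t W u] by blast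
  then show "u = Zero C Y W" using z o W hom_zeroD Zero_Cmp by metis
qed (use W tri_D[OF t] in auto)

lemma tri_zero_hom_zero_into_iff:
  assumes t: "tri C X Y Z f g h" and X: "zero_obj C X" and W: "W \<in> Obj C"
  shows "hom_zero C W Y \<longleftrightarrow> hom_zero C W Z"
  using tri_hom_zero_into[OF t W] tri_hom_zero_into[OF tri_rotate_right[OF t] W]
    zero_obj_hom_zero_right W X zero_obj_ShO by blast

lemma tri_zero_hom_zero_from_iff:
  assumes t: "tri C X Y Z f g h" and X: "zero_obj C X" and W: "W \<in> Obj C"
  shows "hom_zero C Y W \<longleftrightarrow> hom_zero C Z W"
  using tri_hom_zero_from[OF t W] tri_hom_zero_from[OF tri_rotate_right[OF t] W]
    zero_obj_hom_zero_left W X zero_obj_ShO by blast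

text \<open>A section \<open>s\<close> of \<open>g\<close> exists because \<open>h = 0\<close>; the idempotent \<open>1 - s g\<close> is killed by \<open>g\<close>, hence
  factors through \<open>f\<close>, and this factorisation is the retraction onto \<open>X\<close>. Its remaining equations may be
  checked after composing with \<open>f\<close>, which is a monomorphism, again because \<open>h = 0\<close>.\<close>

lemma tri_split:
  assumes t: "tri C X Y Z f g h" and h0: "h = Zero C Z (ShO C X)"
  shows "direct_sum C X Z Y"
proof -
  note o = tri_D[OF t]
  note S = ShO_in_Obj[OF o(1)] ShO_in_Obj[OF o(2)]
  have "h \<cdot> Idn C Z = Zero C Z (ShO C X)" using h0 o S by (simp add: Cmp_Idn)
  then obtain s where s: "s \<in> Hom C Z Y" "g \<cdot> s = Idn C Z"
    using tri_lift[OF tri_rotate_right[OF t] o(3) Idn_in_Hom[OF o(3)]] by metis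
  have sg: "s \<cdot> g \<in> Hom C Y Y" using s o Cmp_in_Hom by blast
  define e where "e = Idn C Y \<oplus> Neg C Y Y (s \<cdot> g)"
  have e: "e \<in> Hom C Y Y" unfolding e_def using o sg Add_in_Hom Idn_in_Hom Neg_in_Hom by simp
  have e_sum: "e \<oplus> (s \<cdot> g) = Idn C Y"
  proof -
    have "e \<oplus> (s \<cdot> g) = Idn C Y \<oplus> (Neg C Y Y (s \<cdot> g) \<oplus> (s \<cdot> g))"
      unfolding e_def using o sg by (simp add: Add_assoc Idn_in_Hom Neg_in_Hom)
    also have "Neg C Y Y (s \<cdot> g) \<oplus> (s \<cdot> g) = Zero C Y Y"
      using o sg Add_comm[of Y Y "Neg C Y Y (s \<cdot> g)" "s \<cdot> g"] Neg_in_Hom[of Y Y "s \<cdot> g"]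
      by (simp add: Add_Neg)
    finally show ?thesis using o by (simp add: Add_Zero Idn_in_Hom)
  qed
  have "g \<cdot> (s \<cdot> g) = g" using s o by (simp add: Cmp_assoc Idn_Cmp)
  then have ge: "g \<cdot> e = Zero C Y Z"
    unfolding e_def using o sg
    by (simp add: Cmp_Add_right Idn_in_Hom Neg_in_Hom Cmp_Idn Cmp_Neg Add_Neg)
  obtain t' where t': "t' \<in> Hom C Y X" "e = f \<cdot> t'" using tri_lift[OF t o(2) e ge] .
  \<comment> \<open>The kernel of \<open>f\<close> is controlled by the map \<open>Z[-1] \<rightarrow> X\<close>; rotating twice avoids desuspending \<open>Z\<close>.\<close>
  have mono: "a = b" if a: "a \<in> Hom C W X" and b: "b \<in> Hom C W X" and W: "W \<in> Obj C"
    and eq: "f \<cdot> a = f \<cdot> b" for W a b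
  proof -
    define d where "d = a \<oplus> Neg C W X b"
    have d: "d \<in> Hom C W X" unfolding d_def using a b W o Add_in_Hom Neg_in_Hom by simp
    have "f \<cdot> d = Zero C W Y" unfolding d_def using a b W o eq
      by (simp add: Cmp_Add_right Neg_in_Hom Cmp_Neg Add_Neg Cmp_in_Hom)
    then have "ShM C f \<cdot> ShM C d = Zero C (ShO C W) (ShO C Y)"
      using d W o by (simp flip: ShM_Cmp add: ShM_Zero)
    then have fd: "Neg C (ShO C X) (ShO C Y) (ShM C f) \<cdot> ShM C d = Zero C (ShO C W) (ShO C Y)"
      using d W o S ShO_in_Obj[OF W] by (simp add: Neg_Cmp ShM_in_Hom Neg_Zero)
    obtain v where v: "v \<in> Hom C (ShO C W) Z" "ShM C d = h \<cdot> v"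
      using tri_lift[OF tri_rotate_right[OF tri_rotate_right[OF t]] ShO_in_Obj[OF W]
          ShM_in_Hom[OF W o(1) d] fd] .
    then have "ShM C d = ShM C (Zero C W X)"
      using h0 W o S ShO_in_Obj[OF W] by (simp add: Zero_Cmp ShM_Zero)
    then have "d = Zero C W X" using ShM_inj d W o Zero_in_Hom by metis
    then show "a = b" unfolding d_def
      by (rule diff_Zero_eq[OF W o(1) a b])
  qed
  have "t' \<cdot> f = Idn C X"
  proof (rule mono)
    have "(e \<oplus> (s \<cdot> g)) \<cdot> f = e \<cdot> f \<oplus> s \<cdot> (g \<cdot> f)"
      using e sg o s by (simp add: Cmp_Add_left Cmp_assoc)
    also have "\<dots> = e \<cdot> f" using tri_Cmp_Zero[OF t] s o e
      by (simp add: Cmp_Zero Add_Zero Cmp_in_Hom)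
    finally have "e \<cdot> f = f" using e_sum o by (simp add: Idn_Cmp)
    then show "f \<cdot> (t' \<cdot> f) = f \<cdot> Idn C X" using t' o by (simp add: Cmp_assoc Cmp_Idn)
  qed (use t' o Cmp_in_Hom Idn_in_Hom in auto)
  moreover have "t' \<cdot> s = Zero C Z X"
  proof (rule mono[where W = Z])
    have es: "e \<cdot> s \<in> Hom C Z Y" using e s o Cmp_in_Hom by blast
    have "(s \<cdot> g) \<cdot> s = s" using s o by (simp flip: Cmp_assoc add: Cmp_Idn)
    then have "(e \<cdot> s) \<oplus> s = s"
      using Cmp_Add_left[of Z Y Y s e "s \<cdot> g"] e_sum e sg o s by (simp add: Idn_Cmp)
    then have "s \<oplus> (e \<cdot> s) = s \<oplus> Zero C Z Y"
      using Add_comm[of Z Y "e \<cdot> s" s] es s o by (simp add: Add_Zero)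
    then have "e \<cdot> s = Zero C Z Y"
      by (rule Add_left_cancel[OF o(3,2) s(1) es Zero_in_Hom[OF o(3,2)]])
    then show "f \<cdot> (t' \<cdot> s) = f \<cdot> Zero C Z X" using t' o s by (simp add: Cmp_assoc Cmp_Zero)
  qed (use t' o s Cmp_in_Hom Zero_in_Hom in auto)
  ultimately show ?thesis unfolding direct_sum_def
    using o s t' e_sum tri_Cmp_Zero[OF t] by blast
qed

end


section \<open>Cotorsion pairs and their perpendicular classes\<close>

context triangulated_category
begin

lemma cotorsion_pairD:
  assumes "(\<U>, \<V>) \<in> cotorsion_pairs C"
  shows "add_summand_closed C \<U>" "add_summand_closed C \<V>" "ext1_zero C \<U> \<V>"
    "\<U> \<subseteq> Obj C" "\<V> \<subseteq> Obj C"
proof -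
  show 1: "add_summand_closed C \<U>" "add_summand_closed C \<V>" "ext1_zero C \<U> \<V>"
    using assms unfolding cotorsion_pairs_def by blast+
  show "\<U> \<subseteq> Obj C" "\<V> \<subseteq> Obj C"
    using 1 unfolding add_summand_closed_def by blast+
qed

lemma cotorsion_pair_triangle:
  assumes UV: "(\<U>, \<V>) \<in> cotorsion_pairs C" and X: "X \<in> Obj C"
  obtains U V k f g where "U \<in> \<U>" "V \<in> \<V>" "tri C V U X k f g"
proof -
  have "Obj C = star C \<U> (shift C \<V>)" using UV unfolding cotorsion_pairs_def by blast
  then have "X \<in> star C \<U> (shift C \<V>)" using X by blast
  then obtain U V f g h where U: "U \<in> \<U>" and V: "V \<in> \<V>" and t: "tri C U X (ShO C V) f g h"
    unfolding star_def shift_def by blast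
  obtain k where k: "tri C V U X k f g"
    using tri_rotate_left[OF t] V cotorsion_pairD(5)[OF UV] by blast
  show ?thesis by (rule that[OF U V k])
qed

lemma direct_summand_mem:
  "\<lbrakk>add_summand_closed C \<A>; direct_sum C X Y Z; Z \<in> \<A>\<rbrakk> \<Longrightarrow> X \<in> \<A>"
  unfolding add_summand_closed_def by blast

text \<open>If \<open>X\<close> has no maps to \<open>\<V>[1]\<close>, then its triangle \<open>V \<rightarrow> U \<rightarrow> X \<rightarrow> V[1]\<close> splits and \<open>X\<close> is a summand
  of \<open>U\<close>.\<close>

lemma cotorsion_fst_iff:
  assumes UV: "(\<U>, \<V>) \<in> cotorsion_pairs C"
  shows "X \<in> \<U> \<longleftrightarrow> X \<in> Obj C \<and> (\<forall>V\<in>\<V>. hom_zero C X (ShO C V))"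
proof
  assume "X \<in> \<U>"
  then show "X \<in> Obj C \<and> (\<forall>V\<in>\<V>. hom_zero C X (ShO C V))"
    using cotorsion_pairD[OF UV] unfolding ext1_zero_def by blast
next
  assume X: "X \<in> Obj C \<and> (\<forall>V\<in>\<V>. hom_zero C X (ShO C V))"
  obtain U V k f g where U: "U \<in> \<U>" and V: "V \<in> \<V>" and t: "tri C V U X k f g"
    by (rule cotorsion_pair_triangle[OF UV conjunct1[OF X]])
  have "g = Zero C X (ShO C V)" using X V tri_D(6)[OF t] hom_zeroD by blast
  then have "direct_sum C X V U" by (rule direct_sum_commute[OF tri_split[OF t]])
  then show "X \<in> \<U>" by (rule direct_summand_mem[OF cotorsion_pairD(1)[OF UV] _ U])
qed

text \<open>Dually, the triangle of \<open>Y[1]\<close> rotates to \<open>Y \<rightarrow> V \<rightarrow> U \<rightarrow> Y[1]\<close>, which splits if \<open>\<U>\<close> has no maps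
  to \<open>Y[1]\<close>.\<close>

lemma cotorsion_snd_iff:
  assumes UV: "(\<U>, \<V>) \<in> cotorsion_pairs C"
  shows "Y \<in> \<V> \<longleftrightarrow> Y \<in> Obj C \<and> (\<forall>U\<in>\<U>. hom_zero C U (ShO C Y))"
proof
  assume "Y \<in> \<V>"
  then show "Y \<in> Obj C \<and> (\<forall>U\<in>\<U>. hom_zero C U (ShO C Y))"
    using cotorsion_pairD[OF UV] unfolding ext1_zero_def by blast
next
  assume Y: "Y \<in> Obj C \<and> (\<forall>U\<in>\<U>. hom_zero C U (ShO C Y))"
  obtain U V k f g where U: "U \<in> \<U>" and V: "V \<in> \<V>" and t: "tri C V U (ShO C Y) k f g"
    by (rule cotorsion_pair_triangle[OF UV ShO_in_Obj[OF conjunct1[OF Y]]])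
  have f: "f = Zero C U (ShO C Y)" using Y U tri_D(5)[OF t] hom_zeroD by blast
  obtain k' where t': "tri C Y V U k' k f" by (rule tri_rotate_left[OF t conjunct1[OF Y]])
  show "Y \<in> \<V>"
    by (rule direct_summand_mem[OF cotorsion_pairD(2)[OF UV] tri_split[OF t' f] V])
qed

end


section \<open>Adjunctions\<close>

context adjunction
begin

lemma unit_transpose:
  assumes X: "X \<in> Obj A" and Y: "Y \<in> Obj B" and f: "f \<in> Hom A X (FO G Y)"
  shows "FM G (\<epsilon> Y \<cdot>\<^bsub>B\<^esub> FM F f) \<cdot>\<^bsub>A\<^esub> \<eta> X = f"
proof -
  note FX = F.FO_in_Obj[OF X] and GY = G.FO_in_Obj[OF Y]
  note FGY = F.FO_in_Obj[OF GY] and GFX = G.FO_in_Obj[OF FX]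
  note GFGY = G.FO_in_Obj[OF FGY]
  note Ff = F.FM_in_Hom[OF X GY f] and cY = counit_in_Hom[OF Y]
  have "FM G (\<epsilon> Y \<cdot>\<^bsub>B\<^esub> FM F f) \<cdot>\<^bsub>A\<^esub> \<eta> X
      = (FM G (\<epsilon> Y) \<cdot>\<^bsub>A\<^esub> FM G (FM F f)) \<cdot>\<^bsub>A\<^esub> \<eta> X"
    by (subst G.FM_Cmp[OF FX FGY Y Ff cY]) (rule refl)
  also have "\<dots> = FM G (\<epsilon> Y) \<cdot>\<^bsub>A\<^esub> (FM G (FM F f) \<cdot>\<^bsub>A\<^esub> \<eta> X)"
    by (rule F.A.Cmp_assoc[OF X GFX GFGY GY unit_in_Hom[OF X] G.FM_in_Hom[OF FX FGY Ff]
          G.FM_in_Hom[OF FGY Y cY], symmetric])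
  also have "\<dots> = FM G (\<epsilon> Y) \<cdot>\<^bsub>A\<^esub> (\<eta> (FO G Y) \<cdot>\<^bsub>A\<^esub> f)"
    by (subst unit_natural[OF X GY f]) (rule refl)
  also have "\<dots> = (FM G (\<epsilon> Y) \<cdot>\<^bsub>A\<^esub> \<eta> (FO G Y)) \<cdot>\<^bsub>A\<^esub> f"
    by (rule F.A.Cmp_assoc[OF X GY GFGY GY f unit_in_Hom[OF GY] G.FM_in_Hom[OF FGY Y cY]])
  also have "\<dots> = f" by (subst triangle_G[OF Y]) (rule F.A.Idn_Cmp[OF X GY f])
  finally show ?thesis .
qed

lemma counit_transpose:
  assumes X: "X \<in> Obj A" and Y: "Y \<in> Obj B" and g: "g \<in> Hom B (FO F X) Y"
  shows "\<epsilon> Y \<cdot>\<^bsub>B\<^esub> FM F (FM G g \<cdot>\<^bsub>A\<^esub> \<eta> X) = g"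
proof -
  note FX = F.FO_in_Obj[OF X] and GY = G.FO_in_Obj[OF Y]
  note FGY = F.FO_in_Obj[OF GY] and GFX = G.FO_in_Obj[OF FX]
  note FGFX = F.FO_in_Obj[OF GFX]
  note Gg = G.FM_in_Hom[OF FX Y g] and uX = unit_in_Hom[OF X]
  have "\<epsilon> Y \<cdot>\<^bsub>B\<^esub> FM F (FM G g \<cdot>\<^bsub>A\<^esub> \<eta> X)
      = \<epsilon> Y \<cdot>\<^bsub>B\<^esub> (FM F (FM G g) \<cdot>\<^bsub>B\<^esub> FM F (\<eta> X))"
    by (subst F.FM_Cmp[OF X GFX GY uX Gg]) (rule refl)
  also have "\<dots> = (\<epsilon> Y \<cdot>\<^bsub>B\<^esub> FM F (FM G g)) \<cdot>\<^bsub>B\<^esub> FM F (\<eta> X)"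
    by (rule F.B.Cmp_assoc[OF FX FGFX FGY Y F.FM_in_Hom[OF X GFX uX] F.FM_in_Hom[OF GFX GY Gg]
          counit_in_Hom[OF Y]])
  also have "\<dots> = (g \<cdot>\<^bsub>B\<^esub> \<epsilon> (FO F X)) \<cdot>\<^bsub>B\<^esub> FM F (\<eta> X)"
    by (subst counit_natural[OF FX Y g]) (rule refl)
  also have "\<dots> = g \<cdot>\<^bsub>B\<^esub> (\<epsilon> (FO F X) \<cdot>\<^bsub>B\<^esub> FM F (\<eta> X))"
    by (rule F.B.Cmp_assoc[OF FX FGFX FX Y F.FM_in_Hom[OF X GFX uX] counit_in_Hom[OF FX] g,
          symmetric])
  also have "\<dots> = g" by (subst triangle_F[OF X]) (rule F.B.Cmp_Idn[OF FX Y g])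
  finally show ?thesis .
qed

end

lemma (in additive_category) hom_zero_iff_unique:
  assumes "X \<in> Obj C" "Y \<in> Obj C"
  shows "hom_zero C X Y \<longleftrightarrow> (\<forall>f\<in>Hom C X Y. \<forall>g\<in>Hom C X Y. f = g)"
proof
  assume "hom_zero C X Y"
  then show "\<forall>f\<in>Hom C X Y. \<forall>g\<in>Hom C X Y. f = g" unfolding hom_zero_def by auto
next
  assume "\<forall>f\<in>Hom C X Y. \<forall>g\<in>Hom C X Y. f = g"
  then show "hom_zero C X Y" using hom_zeroI[OF assms] Zero_in_Hom[OF assms] by blast
qed

text \<open>Transposition is a bijection of hom-sets, and a hom-group vanishes if and only if any two of its
  elements agree; this transports vanishing without any computation of zero morphisms.\<close>

lemma adjunction_hom_zero_iff:
  fixes A :: "('o, 'm, 'x) addcat_scheme" and B :: "('p, 'n, 'y) addcat_scheme"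
  assumes adj: "adjunction A B F G \<eta> \<epsilon>"
    and A: "additive_category A" and B: "additive_category B"
    and X: "X \<in> Obj A" and Y: "Y \<in> Obj B"
  shows "hom_zero B (FO F X) Y \<longleftrightarrow> hom_zero A X (FO G Y)"
proof -
  interpret adjunction A B F G \<eta> \<epsilon> by (fact adj)
  interpret A: additive_category A by (fact A)
  interpret B: additive_category B by (fact B)
  note FX = F.FO_in_Obj[OF X] and GY = G.FO_in_Obj[OF Y]
  have 1: "f = g" if all: "\<forall>f\<in>Hom B (FO F X) Y. \<forall>g\<in>Hom B (FO F X) Y. f = g"
    and f: "f \<in> Hom A X (FO G Y)" and g: "g \<in> Hom A X (FO G Y)" for f g
  proof -
    have m: "\<epsilon> Y \<cdot>\<^bsub>B\<^esub> FM F h \<in> Hom B (FO F X) Y" if h: "h \<in> Hom A X (FO G Y)" for h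
      by (rule F.B.Cmp_in_Hom[OF FX F.FO_in_Obj[OF GY] Y F.FM_in_Hom[OF X GY h]
            counit_in_Hom[OF Y]])
    have "\<epsilon> Y \<cdot>\<^bsub>B\<^esub> FM F f = \<epsilon> Y \<cdot>\<^bsub>B\<^esub> FM F g" by (rule all[rule_format, OF m[OF f] m[OF g]])
    then show ?thesis using unit_transpose[OF X Y f] unit_transpose[OF X Y g] by metis
  qed
  have 2: "f = g" if all: "\<forall>f\<in>Hom A X (FO G Y). \<forall>g\<in>Hom A X (FO G Y). f = g"
    and f: "f \<in> Hom B (FO F X) Y" and g: "g \<in> Hom B (FO F X) Y" for f g
  proof -
    have m: "FM G h \<cdot>\<^bsub>A\<^esub> \<eta> X \<in> Hom A X (FO G Y)" if h: "h \<in> Hom B (FO F X) Y" for h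
      by (rule F.A.Cmp_in_Hom[OF X G.FO_in_Obj[OF FX] GY unit_in_Hom[OF X]
            G.FM_in_Hom[OF FX Y h]])
    have "FM G f \<cdot>\<^bsub>A\<^esub> \<eta> X = FM G g \<cdot>\<^bsub>A\<^esub> \<eta> X" by (rule all[rule_format, OF m[OF f] m[OF g]])
    then show ?thesis using counit_transpose[OF X Y f] counit_transpose[OF X Y g] by metis
  qed
  show ?thesis
    unfolding A.hom_zero_iff_unique[OF X GY] B.hom_zero_iff_unique[OF FX Y]
  proof (intro iffI ballI)
    fix f g assume "\<forall>f\<in>Hom B (FO F X) Y. \<forall>g\<in>Hom B (FO F X) Y. f = g"
      "f \<in> Hom A X (FO G Y)" "g \<in> Hom A X (FO G Y)"
    then show "f = g" by (rule 1)
  next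
    fix f g assume "\<forall>f\<in>Hom A X (FO G Y). \<forall>g\<in>Hom A X (FO G Y). f = g"
      "f \<in> Hom B (FO F X) Y" "g \<in> Hom B (FO F X) Y"
    then show "f = g" by (rule 2)
  qed
qed


section \<open>Ideal quotients\<close>

text \<open>If every map \<open>X \<rightarrow> Y\<close> factors through \<open>\<I>\<close>, then so does every difference, hence all maps lie in one
  class. Conversely, a class contains its representative (through the zero maps of some \<open>K \<in> \<I>\<close>), so \<open>f\<close>
  lies in the class of zero.\<close>

lemma (in additive_category) ideal_quotient_hom_zero_iff:
  assumes I: "\<I> \<subseteq> Obj C" "\<I> \<noteq> {}" and X: "X \<in> Obj C" and Y: "Y \<in> Obj C"
  shows "hom_zero (ideal_quotient C \<X> \<I>) X Y
    \<longleftrightarrow> (\<forall>f\<in>Hom C X Y. \<exists>K\<in>\<I>. \<exists>a\<in>Hom C X K. \<exists>b\<in>Hom C K Y. f = b \<cdot> a)"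
    (is "_ \<longleftrightarrow> (\<forall>f\<in>_. ?fac f)")
proof -
  have hz: "hom_zero (ideal_quotient C \<X> \<I>) X Y
      \<longleftrightarrow> (\<forall>f\<in>Hom C X Y. ideal_class C \<I> f = ideal_class C \<I> (Zero C X Y))"
    using Zero_in_Hom[OF X Y] unfolding hom_zero_def ideal_quotient_def by auto
  have eq: "g \<in> ideal_class C \<I> f
      \<longleftrightarrow> g \<in> Hom C X Y \<and> (\<exists>K\<in>\<I>. \<exists>a\<in>Hom C X K. \<exists>b\<in>Hom C K Y. g = f \<oplus> (b \<cdot> a))"
    if f: "f \<in> Hom C X Y" for f g
    unfolding ideal_class_def ideal_eq_def mem_Collect_eq using Hom_disjoint f X Y by blast
  show ?thesis
  proof
    assume "hom_zero (ideal_quotient C \<X> \<I>) X Y"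
    then have cls: "ideal_class C \<I> f = ideal_class C \<I> (Zero C X Y)" if "f \<in> Hom C X Y" for f
      using hz that by blast
    show "\<forall>f\<in>Hom C X Y. ?fac f"
    proof
      fix f assume f: "f \<in> Hom C X Y"
      obtain K where K: "K \<in> \<I>" "K \<in> Obj C" using I by blast
      have "f = f \<oplus> (Zero C K Y \<cdot> Zero C X K)"
        using f K X Y by (simp add: Cmp_Zero Zero_in_Hom Add_Zero)
      then have "f \<in> ideal_class C \<I> f"
        using eq[OF f] f K Zero_in_Hom X Y by blast
      then have "f \<in> ideal_class C \<I> (Zero C X Y)" using cls[OF f] by simp
      then obtain K a b where "K \<in> \<I>" "a \<in> Hom C X K" "b \<in> Hom C K Y" "f = Zero C X Y \<oplus> (b \<cdot> a)"
        using eq[OF Zero_in_Hom[OF X Y]] by blast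
      moreover have "b \<cdot> a \<in> Hom C X Y" using calculation I X Y Cmp_in_Hom by blast
      ultimately show "?fac f" using Zero_Add[OF X Y] by auto
    qed
  next
    assume fac: "\<forall>f\<in>Hom C X Y. ?fac f"
    \<comment> \<open>The class of \<open>f\<close> is the whole hom-set, so it does not depend on \<open>f\<close>.\<close>
    have "ideal_class C \<I> f = Hom C X Y" if f: "f \<in> Hom C X Y" for f
    proof -
      have "g \<in> ideal_class C \<I> f" if g: "g \<in> Hom C X Y" for g
      proof -
        define d where "d = Neg C X Y f \<oplus> g"
        note n = Neg_in_Hom[OF X Y f]
        have "f \<oplus> d = (f \<oplus> Neg C X Y f) \<oplus> g"
          unfolding d_def by (rule Add_assoc[OF X Y f n g, symmetric])
        then have "g = f \<oplus> d" by (simp add: Add_Neg[OF X Y f] Zero_Add[OF X Y g])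
        moreover have "?fac d" using fac Add_in_Hom[OF X Y n g] unfolding d_def by blast
        ultimately show ?thesis using eq[OF f] g by blast
      qed
      then show ?thesis using eq[OF f] by blast
    qed
    then show "hom_zero (ideal_quotient C \<X> \<I>) X Y" using hz Zero_in_Hom[OF X Y] by blast
  qed
qed


section \<open>Full subcategories and essential images\<close>

lemma full_sub_simps [simp]:
  "Obj (full_sub C A) = A" "Hom (full_sub C A) = Hom C" "ShO (full_sub C A) = ShO C"
  by (simp_all add: full_sub_def)

lemma full_sub_hom_zero [simp]: "hom_zero (full_sub C A) X Y = hom_zero C X Y"
  by (simp add: hom_zero_def full_sub_def)

lemma tri_full_subD: "\<lbrakk>tri (full_sub C A) X Y Z f g h; A \<subseteq> Obj C\<rbrakk> \<Longrightarrow> tri C X Y Z f g h"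
  by (auto simp: tri_def candidate_def full_sub_def)

lemma ess_image_ext1_zero_iff:
  fixes C :: "('o, 'm, 'x) tricat_scheme" and D :: "('p, 'n, 'y) tricat_scheme"
  assumes l: "cat_functor C D l" and D: "triangulated_category D"
    and A: "\<A> \<subseteq> Obj C" and B: "\<B> \<subseteq> Obj C"
  shows "ext1_zero D (ess_image D l \<A>) (ess_image D l \<B>)
    \<longleftrightarrow> (\<forall>A\<in>\<A>. \<forall>B\<in>\<B>. hom_zero D (FO l A) (ShO D (FO l B)))"
    (is "?L \<longleftrightarrow> ?R")
proof
  interpret l: cat_functor C D l by (fact l)
  interpret D: triangulated_category D by (fact D)
  have refl: "isomorphic D X X" if "X \<in> Obj D" for X
    using l.B.Idn_in_Hom[OF that] l.B.Cmp_Idn[OF that that] unfolding isomorphic_def iso_arr_def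
    by blast
  {
    assume L: ?L
    have "FO l A \<in> ess_image D l \<A>" if "A \<in> \<A>" for A
      using that A l.FO_in_Obj refl unfolding ess_image_def by blast
    moreover have "FO l B \<in> ess_image D l \<B>" if "B \<in> \<B>" for B
      using that B l.FO_in_Obj refl unfolding ess_image_def by blast
    ultimately show ?R using L unfolding ext1_zero_def by blast
  next
    assume R: ?R
    show ?L unfolding ext1_zero_def
    proof (intro ballI)
      fix X Y assume X: "X \<in> ess_image D l \<A>" and Y: "Y \<in> ess_image D l \<B>"
      obtain A where A': "A \<in> \<A>" "isomorphic D (FO l A) X" and XO: "X \<in> Obj D"
        using X unfolding ess_image_def by blast
      obtain B where B': "B \<in> \<B>" "isomorphic D (FO l B) Y" and YO: "Y \<in> Obj D"
        using Y unfolding ess_image_def by blast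
      have o: "FO l A \<in> Obj D" "FO l B \<in> Obj D" using A' B' A B l.FO_in_Obj by blast+
      show "hom_zero D X (ShO D Y)"
        by (rule D.hom_zero_iso[OF o(1) XO D.ShO_in_Obj[OF o(2)] D.ShO_in_Obj[OF YO] A'(2)
              D.isomorphic_ShO[OF o(2) YO B'(2)]]) (use R A' B' in blast)
    qed
  }
qed


section \<open>Cotorsion pairs over a recollement\<close>

text \<open>This is the half of a recollement that the comparison relies on, with explicit units and counits:
  both adjoints of the inclusion \<open>\<N> \<rightarrow> C\<close>, the right adjoint of \<open>l\<close>, and the gluing triangle between
  them. Here \<open>D\<close> is any triangulated category with these data.\<close>

locale recollement_with_cotorsion_pair =
  C: triangulated_category C + N: triangulated_category "full_sub C \<N>" +
  D: triangulated_category D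
  for C :: "('o, 'm, 'x) tricat_scheme" (structure) and \<N> :: "'o set"
    and D :: "('p, 'n, 'y) tricat_scheme" +
  fixes l :: "('o, 'm, 'p, 'n) fctr" and i_star i_shriek :: "('o, 'm, 'o, 'm) fctr"
    and j_star :: "('p, 'n, 'o, 'm) fctr"
    and \<eta> \<epsilon> \<eta>' \<epsilon>' \<theta> :: "'o \<Rightarrow> 'm" and \<delta> :: "'p \<Rightarrow> 'n" and \<S> \<V> :: "'o set"
  assumes N: "triangulated_subcategory C \<N>"
    and l: "triangle_functor C D l"
    and l_zero: "X \<in> \<N> \<Longrightarrow> zero_obj D (FO l X)"
    and left_adjoint: "adjunction C (full_sub C \<N>) i_star incl_fctr \<eta> \<epsilon>"
    and right_adjoint: "adjunction (full_sub C \<N>) C incl_fctr i_shriek \<eta>' \<epsilon>'"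
    and l_adjoint: "adjunction C D l j_star \<theta> \<delta>"
    and gluing: "X \<in> Obj C \<Longrightarrow> \<exists>h. tri C (FO i_shriek X) X (FO j_star (FO l X)) (\<epsilon>' X) (\<theta> X) h"
    and SV: "(\<S>, \<V>) \<in> cotorsion_pairs (full_sub C \<N>)"
begin

lemma N_subset: "\<N> \<subseteq> Obj C" and N_ShO_iff: "X \<in> Obj C \<Longrightarrow> ShO C X \<in> \<N> \<longleftrightarrow> X \<in> \<N>"
  using N unfolding triangulated_subcategory_def by blast+

lemma S_subset: "\<S> \<subseteq> \<N>" and V_subset: "\<V> \<subseteq> \<N>"
  using N.cotorsion_pairD(4,5)[OF SV] by simp_all

lemma unshift_S_subset: "unshift C \<S> \<subseteq> \<N>"
  using S_subset N_ShO_iff unfolding unshift_def by blast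

lemma preimage_i_star_eq: "preimage C i_star \<S> = left_perp C (shift C \<V>)"
proof -
  interpret left: adjunction C "full_sub C \<N>" i_star incl_fctr \<eta> \<epsilon> by (fact left_adjoint)
  have "FO i_star X \<in> \<S> \<longleftrightarrow> (\<forall>V\<in>\<V>. hom_zero C X (ShO C V))" if X: "X \<in> Obj C" for X
  proof -
    have "hom_zero C (FO i_star X) (ShO C V) \<longleftrightarrow> hom_zero C X (ShO C V)" if "V \<in> \<V>" for V
      using adjunction_hom_zero_iff[OF left_adjoint C.additive_category_axioms
          N.additive_category_axioms X, of "ShO C V"] that V_subset N_subset N_ShO_iff
      by (auto simp: incl_fctr_def)
    moreover have "FO i_star X \<in> \<N>" using left.F.FO_in_Obj[OF X] by simp
    ultimately show ?thesis using N.cotorsion_fst_iff[OF SV, of "FO i_star X"] by simp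
  qed
  then show ?thesis unfolding preimage_def left_perp_def shift_def by blast
qed

lemma preimage_i_shriek_eq: "preimage C i_shriek \<V> = right_perp C (unshift C \<S>)"
proof -
  interpret right: adjunction "full_sub C \<N>" C incl_fctr i_shriek \<eta>' \<epsilon>' by (fact right_adjoint)
  have "FO i_shriek X \<in> \<V> \<longleftrightarrow> (\<forall>R\<in>unshift C \<S>. hom_zero C R X)" if X: "X \<in> Obj C" for X
  proof -
    have iX: "FO i_shriek X \<in> \<N>" using right.G.FO_in_Obj[OF X] by simp
    have hom: "hom_zero C (ShO C R) (ShO C (FO i_shriek X)) \<longleftrightarrow> hom_zero C R X"
      if R: "R \<in> \<N>" for R
      using adjunction_hom_zero_iff[OF right_adjoint N.additive_category_axioms
          C.additive_category_axioms, of R X] R X iX N.hom_zero_ShO_iff[of R "FO i_shriek X"]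
      by (simp add: incl_fctr_def)
    have "(\<forall>S\<in>\<S>. hom_zero C S (ShO C (FO i_shriek X))) \<longleftrightarrow> (\<forall>R\<in>unshift C \<S>. hom_zero C R X)"
    proof
      assume a: "\<forall>S\<in>\<S>. hom_zero C S (ShO C (FO i_shriek X))"
      show "\<forall>R\<in>unshift C \<S>. hom_zero C R X"
      proof
        fix R assume R: "R \<in> unshift C \<S>"
        then have "ShO C R \<in> \<S>" by (simp add: unshift_def)
        then show "hom_zero C R X" using a hom R unshift_S_subset by blast
      qed
    next
      assume a: "\<forall>R\<in>unshift C \<S>. hom_zero C R X"
      show "\<forall>S\<in>\<S>. hom_zero C S (ShO C (FO i_shriek X))"
      proof
        fix S assume S: "S \<in> \<S>"
        then have "S \<in> Obj C" using S_subset N_subset by blast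
        then obtain R where R: "R \<in> Obj C" "ShO C R = S" using C.ShO_surj by blast
        then have "R \<in> unshift C \<S>" using S by (simp add: unshift_def)
        then show "hom_zero C S (ShO C (FO i_shriek X))"
          using a hom R unshift_S_subset by blast
      qed
    qed
    then show ?thesis using N.cotorsion_snd_iff[OF SV, of "FO i_shriek X"] iX by simp
  qed
  then show ?thesis unfolding preimage_def right_perp_def by blast
qed

abbreviation "\<U> \<equiv> preimage C i_star \<S>"
abbreviation "\<T> \<equiv> preimage C i_shriek \<V>"

lemma U_hom_zero: "\<lbrakk>X \<in> \<U>; V \<in> \<V>\<rbrakk> \<Longrightarrow> hom_zero C X (ShO C V)"
  unfolding preimage_i_star_eq left_perp_def shift_def by blast

lemma T_hom_zero: "\<lbrakk>X \<in> \<T>; R \<in> unshift C \<S>\<rbrakk> \<Longrightarrow> hom_zero C R X"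
  unfolding preimage_i_shriek_eq right_perp_def by blast

lemma V_subset_T: "\<V> \<subseteq> \<T>"
proof
  fix V assume V: "V \<in> \<V>"
  then have VN: "V \<in> \<N>" "V \<in> Obj C" using V_subset N_subset by blast+
  have "hom_zero C R V" if R: "R \<in> unshift C \<S>" for R
  proof -
    have "ShO C R \<in> \<S>" "R \<in> Obj C" using R by (auto simp: unshift_def)
    then show ?thesis
      using N.cotorsion_pairD(3)[OF SV] V C.hom_zero_ShO_iff[of R V] VN
      unfolding ext1_zero_def by simp
  qed
  then show "V \<in> \<T>" using VN unfolding preimage_i_shriek_eq right_perp_def by blast
qed

text \<open>In the triangle \<open>V' \<rightarrow> S \<rightarrow> V \<rightarrow> V'[1]\<close> that \<open>(\<S>, \<V>)\<close> provides for \<open>V\<close>, the object \<open>S\<close> is an extension of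
  objects of \<open>\<V> \<subseteq> \<T>\<close> and so lies in \<open>\<S> \<inter> \<T>\<close>, while the obstruction \<open>X \<rightarrow> V'[1]\<close> to lifting \<open>f\<close> to \<open>S\<close> vanishes
  since \<open>X \<in> \<U>\<close>.\<close>

lemma factors_through_core:
  assumes X: "X \<in> \<U>" and V: "V \<in> \<V>" and f: "f \<in> Hom C X V"
  shows "\<exists>K\<in>\<S> \<inter> \<T>. \<exists>a\<in>Hom C X K. \<exists>b\<in>Hom C K V. f = b \<cdot> a"
proof -
  have XO: "X \<in> Obj C" using X by (simp add: preimage_def)
  have "V \<in> \<N>" using V V_subset by blast
  then obtain S V' k a b where S: "S \<in> \<S>" and V': "V' \<in> \<V>"
    and t: "tri C V' S V k a b"
    using N.cotorsion_pair_triangle[OF SV, of V] tri_full_subD[OF _ N_subset] by simp metis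
  have "S \<in> \<T>"
  proof -
    have "hom_zero C R S" if R: "R \<in> unshift C \<S>" for R
    proof (rule C.tri_hom_zero_into[OF t])
      show "R \<in> Obj C" using R by (simp add: unshift_def)
    qed (use T_hom_zero R V V' V_subset_T in blast)+
    then show ?thesis
      using C.tri_D(2)[OF t] unfolding preimage_i_shriek_eq right_perp_def by blast
  qed
  moreover have "b \<cdot> f = Zero C X (ShO C V')"
    using C.hom_zeroD[OF U_hom_zero[OF X V']]
      C.Cmp_in_Hom[OF XO C.tri_D(3)[OF t] C.ShO_in_Obj[OF C.tri_D(1)[OF t]] f C.tri_D(6)[OF t]]
    by blast
  then obtain u where "u \<in> Hom C X S" "f = a \<cdot> u"
    by (rule C.tri_lift[OF C.tri_rotate_right[OF t] XO f])
  ultimately show ?thesis using S C.tri_D(5)[OF t] by blast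
qed

text \<open>Morphisms \<open>l X \<rightarrow> l W\<close> are maps \<open>X \<rightarrow> j\<^sub>* (l W)\<close>. From left to right, the composite of \<open>f\<close> with the unit
  of \<open>W\<close> is the transpose of \<open>l f = 0\<close>, so \<open>f\<close> factors through \<open>i\<^sup>! W \<in> \<V>\<close>. From right to left, the transpose of \<open>g\<close> lifts along the unit of \<open>W\<close>, so
  that \<open>g = l f\<close>; and \<open>l\<close> kills every map that factors through \<open>\<S> \<subseteq> \<N>\<close>.\<close>

lemma l_hom_zero_iff:
  assumes X: "X \<in> \<U>" and W: "W \<in> \<T>"
  shows "hom_zero D (FO l X) (FO l W)
    \<longleftrightarrow> (\<forall>f\<in>Hom C X W. \<exists>K\<in>\<S> \<inter> \<T>. \<exists>a\<in>Hom C X K. \<exists>b\<in>Hom C K W. f = b \<cdot> a)"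
proof -
  interpret quot: adjunction C D l j_star \<theta> \<delta> by (fact l_adjoint)
  have XO: "X \<in> Obj C" and WO: "W \<in> Obj C" and iW: "FO i_shriek W \<in> \<V>"
    using X W by (auto simp: preimage_def)
  note lX = quot.F.FO_in_Obj[OF XO] and lW = quot.F.FO_in_Obj[OF WO]
  note jX = quot.G.FO_in_Obj[OF lX] and jW = quot.G.FO_in_Obj[OF lW]
  obtain h where t: "tri C (FO i_shriek W) W (FO j_star (FO l W)) (\<epsilon>' W) (\<theta> W) h"
    using gluing[OF WO] by blast
  note iWO = C.tri_D(1)[OF t] and e = C.tri_D(4)[OF t] and u = C.tri_D(5)[OF t]
  show ?thesis
  proof
    assume z: "hom_zero D (FO l X) (FO l W)"
    show "\<forall>f\<in>Hom C X W. \<exists>K\<in>\<S> \<inter> \<T>. \<exists>a\<in>Hom C X K. \<exists>b\<in>Hom C K W. f = b \<cdot> a"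
    proof
      fix f assume f: "f \<in> Hom C X W"
      note f0 = C.Zero_in_Hom[OF XO WO]
      have "FM l f = FM l (Zero C X W)"
        using D.hom_zeroD[OF z quot.F.FM_in_Hom[OF XO WO f]]
          D.hom_zeroD[OF z quot.F.FM_in_Hom[OF XO WO f0]] by simp
      then have "\<theta> W \<cdot> f = \<theta> W \<cdot> Zero C X W"
        using quot.unit_natural[OF XO WO f] quot.unit_natural[OF XO WO f0] by simp
      then have "\<theta> W \<cdot> f = Zero C X (FO j_star (FO l W))"
        using C.Cmp_Zero[OF XO WO jW u] by simp
      then obtain v where v: "v \<in> Hom C X (FO i_shriek W)" "f = \<epsilon>' W \<cdot> v"
        by (rule C.tri_lift[OF t XO f])
      obtain K a b where K: "K \<in> \<S> \<inter> \<T>" and a: "a \<in> Hom C X K"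
        and b: "b \<in> Hom C K (FO i_shriek W)" and ba: "v = b \<cdot> a"
        using factors_through_core[OF X iW v(1)] by blast
      have KO: "K \<in> Obj C" using K by (simp add: preimage_def)
      have "f = (\<epsilon>' W \<cdot> b) \<cdot> a"
        using v(2) ba C.Cmp_assoc[OF XO KO iWO WO a b e] by simp
      then show "\<exists>K\<in>\<S> \<inter> \<T>. \<exists>a\<in>Hom C X K. \<exists>b\<in>Hom C K W. f = b \<cdot> a"
        using K a C.Cmp_in_Hom[OF KO iWO WO b e] by blast
    qed
  next
    assume fac: "\<forall>f\<in>Hom C X W. \<exists>K\<in>\<S> \<inter> \<T>. \<exists>a\<in>Hom C X K. \<exists>b\<in>Hom C K W. f = b \<cdot> a"
    have lf: "FM l f = Zero D (FO l X) (FO l W)" if f: "f \<in> Hom C X W" for f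
    proof -
      obtain K a b where K: "K \<in> \<S> \<inter> \<T>" and a: "a \<in> Hom C X K" and b: "b \<in> Hom C K W"
        and ba: "f = b \<cdot> a"
        using fac f by blast
      have KO: "K \<in> Obj C" and KN: "K \<in> \<N>" using K S_subset N_subset by blast+
      have "FM l f = FM l b \<cdot>\<^bsub>D\<^esub> FM l a" using ba quot.F.FM_Cmp[OF XO KO WO a b] by simp
      also have "\<dots> = Zero D (FO l X) (FO l W)"
        by (rule D.Zero_unique_through[OF lX lW l_zero[OF KN] quot.F.FM_in_Hom[OF XO KO a]
              quot.F.FM_in_Hom[OF KO WO b]])
      finally show ?thesis .
    qed
    show "hom_zero D (FO l X) (FO l W)"
    proof (rule D.hom_zeroI[OF lX lW])
      fix g assume g: "g \<in> Hom D (FO l X) (FO l W)"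
      define g' where "g' = FM j_star g \<cdot> \<theta> X"
      have g': "g' \<in> Hom C X (FO j_star (FO l W))"
        unfolding g'_def
        by (rule C.Cmp_in_Hom[OF XO jX jW quot.unit_in_Hom[OF XO] quot.G.FM_in_Hom[OF lX lW g]])
      \<comment> \<open>The obstruction to lifting \<open>g'\<close> to \<open>W\<close> is a map from \<open>\<U>\<close> to \<open>\<V>[1]\<close>.\<close>
      have "h \<cdot> g' = Zero C X (ShO C (FO i_shriek W))"
        by (rule C.hom_zeroD[OF U_hom_zero[OF X iW]
              C.Cmp_in_Hom[OF XO jW C.ShO_in_Obj[OF iWO] g' C.tri_D(6)[OF t]]])
      then obtain f where f: "f \<in> Hom C X W" "g' = \<theta> W \<cdot> f"
        by (rule C.tri_lift[OF C.tri_rotate_right[OF t] XO g'])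
      note lj = quot.F.FO_in_Obj[OF jW]
      note lu = quot.F.FM_in_Hom[OF WO jW u] and c = quot.counit_in_Hom[OF lW]
      have "g = \<delta> (FO l W) \<cdot>\<^bsub>D\<^esub> FM l (\<theta> W \<cdot> f)"
        using quot.counit_transpose[OF XO lW g] f(2) unfolding g'_def by simp
      also have "\<dots> = \<delta> (FO l W) \<cdot>\<^bsub>D\<^esub> (FM l (\<theta> W) \<cdot>\<^bsub>D\<^esub> FM l f)"
        by (subst quot.F.FM_Cmp[OF XO WO jW f(1) u]) (rule refl)
      also have "\<dots> = Zero D (FO l X) (FO l W)"
        by (simp only: lf[OF f(1)] D.Cmp_Zero[OF lX lW lj lu] D.Cmp_Zero[OF lX lj lW c])
      finally show "g = Zero D (FO l X) (FO l W)" .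
    qed
  qed
qed

lemma l_tri:
  assumes "tri C X Y Z f g h"
  obtains f' g' h' where "tri D (FO l X) (FO l Y) (FO l Z) f' g' h'"
  using l assms unfolding triangle_functor_def by blast

lemma l_functor: "cat_functor C D l"
  using l unfolding triangle_functor_def additive_functor_def by blast

text \<open>The four triangles are those defining \<open>X = \<sigma> A\<close>, \<open>Y = \<omega> B\<close>, \<open>W = Y\<langle>1\<rangle>\<close> and \<open>Z = \<sigma> W\<close>. In each, \<open>l\<close>
  sends one vertex to zero and thereby identifies \<open>A\<close> with \<open>X\<close>, \<open>Y\<close> with \<open>B\<close>, \<open>W\<close> with \<open>Y[1]\<close> and \<open>W\<close> with \<open>Z\<close>
  in \<open>D\<close>, as far as vanishing of morphisms can see.\<close>

lemma ext_vanishing_iff: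
  assumes R: "R \<in> unshift C \<S>" and RAX: "tri C R A X a b c"
    and V: "V \<in> \<V>" and VYB: "tri C V Y B a' b' c'"
    and J: "J \<in> \<S> \<inter> \<T>" and YJW: "tri C Y J W p q r"
    and R': "R' \<in> unshift C \<S>" and RWZ: "tri C R' W Z p' q' r'"
    and X: "X \<in> \<U>" and Z: "Z \<in> \<T>"
  shows "hom_zero (ideal_quotient C \<X> (\<S> \<inter> \<T>)) X Z
    \<longleftrightarrow> hom_zero D (FO l A) (ShO D (FO l B))"
proof -
  interpret l: cat_functor C D l by (fact l_functor)
  have lO: "FO l K \<in> Obj D" if "K \<in> Obj C" for K by (rule l.FO_in_Obj[OF that])
  note XO = C.tri_D(3)[OF RAX] and BO = C.tri_D(3)[OF VYB] and ZO = C.tri_D(3)[OF RWZ]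
  obtain f1 g1 h1 where t1: "tri D (FO l R) (FO l A) (FO l X) f1 g1 h1" by (rule l_tri[OF RAX])
  obtain f2 g2 h2 where t2: "tri D (FO l V) (FO l Y) (FO l B) f2 g2 h2" by (rule l_tri[OF VYB])
  obtain f3 g3 h3 where t3: "tri D (FO l Y) (FO l J) (FO l W) f3 g3 h3" by (rule l_tri[OF YJW])
  obtain f4 g4 h4 where t4: "tri D (FO l R') (FO l W) (FO l Z) f4 g4 h4" by (rule l_tri[OF RWZ])
  obtain f5 g5 h5 where
    t5: "tri D (ShO D (FO l V)) (ShO D (FO l Y)) (ShO D (FO l B)) f5 g5 h5"
    by (rule D.tri_shift[OF t2])
  have z: "zero_obj D (FO l R)" "zero_obj D (FO l R')" "zero_obj D (FO l J)"
    "zero_obj D (ShO D (FO l V))"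
    using R R' J V unshift_S_subset S_subset V_subset D.zero_obj_ShO l_zero by blast+
  have "\<S> \<inter> \<T> \<subseteq> Obj C" "\<S> \<inter> \<T> \<noteq> {}" using J by (auto simp: preimage_def)
  then have "hom_zero (ideal_quotient C \<X> (\<S> \<inter> \<T>)) X Z \<longleftrightarrow> hom_zero D (FO l X) (FO l Z)"
    using C.ideal_quotient_hom_zero_iff[OF _ _ XO ZO] l_hom_zero_iff[OF X Z] by simp
  also have "\<dots> \<longleftrightarrow> hom_zero D (FO l X) (FO l W)"
    using D.tri_zero_hom_zero_into_iff[OF t4 z(2) lO[OF XO]] by simp
  also have "\<dots> \<longleftrightarrow> hom_zero D (FO l X) (ShO D (FO l Y))"
    by (rule D.tri_zero_hom_zero_into_iff[OF D.tri_rotate_right[OF t3] z(3) lO[OF XO]])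
  also have "\<dots> \<longleftrightarrow> hom_zero D (FO l X) (ShO D (FO l B))"
    by (rule D.tri_zero_hom_zero_into_iff[OF t5 z(4) lO[OF XO]])
  also have "\<dots> \<longleftrightarrow> hom_zero D (FO l A) (ShO D (FO l B))"
    using D.tri_zero_hom_zero_from_iff[OF t1 z(1) D.ShO_in_Obj[OF lO[OF BO]]] by simp
  finally show ?thesis .
qed

lemma ext1_ZI_zero_iff:
  fixes \<sigma> \<omega> \<Theta> :: "('o, 'm set, 'o, 'm set) fctr"
  defines "P \<equiv> ((\<S>, \<T>), (\<U>, \<V>))"
  assumes sigma: "is_sigma C P \<sigma>" and omega: "is_omega C P \<omega>" and angle: "is_angle C P \<Theta>"
    and A: "\<A> \<subseteq> \<U>" and B: "\<B> \<subseteq> \<T>"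
  shows "ext1_ZI_zero C P \<sigma> \<Theta> (FO \<sigma> ` \<A>) (FO \<omega> ` \<B>)
    \<longleftrightarrow> ext1_zero D (ess_image D l \<A>) (ess_image D l \<B>)"
proof -
  have "\<exists>\<eta> \<epsilon>. adjunction (ideal_quotient C \<U> (\<S> \<inter> \<T>)) (ideal_quotient C (\<T> \<inter> \<U>) (\<S> \<inter> \<T>))
      \<sigma> incl_fctr \<eta> \<epsilon>"
    and sig: "\<forall>X\<in>\<U>. \<exists>R\<in>unshift C \<S>. \<exists>a b c. tri C R X (FO \<sigma> X) a b c"
    using sigma unfolding P_def is_sigma.simps tcp_I.simps tcp_Z.simps Let_def by blast+
  then have "cat_functor (ideal_quotient C \<U> (\<S> \<inter> \<T>)) (ideal_quotient C (\<T> \<inter> \<U>) (\<S> \<inter> \<T>)) \<sigma>"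
    unfolding adjunction_def by blast
  then have sO: "FO \<sigma> X \<in> \<T> \<inter> \<U>" if "X \<in> \<U>" for X
    using cat_functor.FO_in_Obj that by (fastforce simp: ideal_quotient_def)
  have "\<exists>\<eta> \<epsilon>. adjunction (ideal_quotient C (\<T> \<inter> \<U>) (\<S> \<inter> \<T>)) (ideal_quotient C \<T> (\<S> \<inter> \<T>))
      incl_fctr \<omega> \<eta> \<epsilon>"
    and om: "\<forall>X\<in>\<T>. \<exists>V\<in>\<V>. \<exists>a b c. tri C V (FO \<omega> X) X a b c"
    using omega unfolding P_def is_omega.simps tcp_I.simps tcp_Z.simps Let_def by blast+
  then have "cat_functor (ideal_quotient C \<T> (\<S> \<inter> \<T>)) (ideal_quotient C (\<T> \<inter> \<U>) (\<S> \<inter> \<T>)) \<omega>"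
    unfolding adjunction_def by blast
  then have oO: "FO \<omega> X \<in> \<T> \<inter> \<U>" if "X \<in> \<T>" for X
    using cat_functor.FO_in_Obj that by (fastforce simp: ideal_quotient_def)
  have ang: "\<forall>X\<in>\<T> \<inter> \<U>. FO \<Theta> X \<in> \<U> \<and> (\<exists>J\<in>\<S> \<inter> \<T>. \<exists>a b c. tri C X J (FO \<Theta> X) a b c)"
    using angle unfolding P_def is_angle.simps tcp_I.simps tcp_Z.simps Let_def by blast
  have pair: "hom_zero (ideal_quotient C (\<T> \<inter> \<U>) (\<S> \<inter> \<T>)) (FO \<sigma> A) (FO \<sigma> (FO \<Theta> (FO \<omega> B)))
      \<longleftrightarrow> hom_zero D (FO l A) (ShO D (FO l B))" if A: "A \<in> \<U>" and B: "B \<in> \<T>" for A B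
  proof -
    obtain R a b c where 1: "R \<in> unshift C \<S>" "tri C R A (FO \<sigma> A) a b c"
      using sig A by blast
    obtain V a' b' c' where 2: "V \<in> \<V>" "tri C V (FO \<omega> B) B a' b' c'"
      using om B by blast
    obtain J p q r where 3: "J \<in> \<S> \<inter> \<T>" "tri C (FO \<omega> B) J (FO \<Theta> (FO \<omega> B)) p q r"
      and \<Theta>: "FO \<Theta> (FO \<omega> B) \<in> \<U>"
      using ang oO[OF B] by blast
    obtain R' p' q' r' where 4: "R' \<in> unshift C \<S>"
      "tri C R' (FO \<Theta> (FO \<omega> B)) (FO \<sigma> (FO \<Theta> (FO \<omega> B))) p' q' r'"
      using sig \<Theta> by blast
    show ?thesis
      using ext_vanishing_iff[OF 1 2 3 4] sO[OF A] sO[OF \<Theta>] by blast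
  qed
  have Z: "tcp_Z P = \<T> \<inter> \<U>" and I: "tcp_I P = \<S> \<inter> \<T>" by (simp_all add: P_def)
  have "ext1_ZI_zero C P \<sigma> \<Theta> (FO \<sigma> ` \<A>) (FO \<omega> ` \<B>)
      \<longleftrightarrow> (\<forall>A\<in>\<A>. \<forall>B\<in>\<B>. hom_zero (ideal_quotient C (\<T> \<inter> \<U>) (\<S> \<inter> \<T>)) (FO \<sigma> A)
            (FO \<sigma> (FO \<Theta> (FO \<omega> B))))"
    unfolding ext1_ZI_zero_def Z I by (simp add: comp_fctr_def)
  also have "\<dots> \<longleftrightarrow> (\<forall>A\<in>\<A>. \<forall>B\<in>\<B>. hom_zero D (FO l A) (ShO D (FO l B)))"
    using pair A B by (meson subsetD)
  also have "\<dots> \<longleftrightarrow> ext1_zero D (ess_image D l \<A>) (ess_image D l \<B>)"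
  proof (rule ess_image_ext1_zero_iff[OF l_functor D.triangulated_category_axioms, symmetric])
    show "\<A> \<subseteq> Obj C" "\<B> \<subseteq> Obj C" using A B by (auto simp: preimage_def)
  qed
  finally show ?thesis .
qed

end

lemma recollement_obtain_adjunctions:
  assumes rec: "recollement C \<N> i_star i_shriek j_shriek j_star"
    and SV: "(\<S>, \<V>) \<in> cotorsion_pairs (full_sub C \<N>)"
  obtains \<eta> \<epsilon> \<eta>' \<epsilon>' \<theta> \<delta> where
    "recollement_with_cotorsion_pair C \<N> (verdier C \<N>) (verdier_fctr C \<N>) i_star i_shriek j_star
      \<eta> \<epsilon> \<eta>' \<epsilon>' \<theta> \<delta> \<S> \<V>"
proof -
  have basic: "triangulated_category C" "triangulated_subcategory C \<N>"
    "triangle_functor (full_sub C \<N>) C incl_fctr"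
    "triangle_functor C (verdier C \<N>) (verdier_fctr C \<N>)"
    "\<forall>X\<in>\<N>. zero_obj (verdier C \<N>) (FO (verdier_fctr C \<N>) X)"
    using rec unfolding recollement_def Let_def by (simp_all add: incl_fctr_def)
  obtain \<eta> \<epsilon> \<eta>' \<epsilon>' \<theta>' \<delta>' where adj:
    "adjunction C (full_sub C \<N>) i_star incl_fctr \<eta> \<epsilon>"
    "adjunction (full_sub C \<N>) C incl_fctr i_shriek \<eta>' \<epsilon>'"
    "adjunction C (verdier C \<N>) (verdier_fctr C \<N>) j_star \<theta>' \<delta>'"
    and glue: "\<forall>X\<in>Obj C. \<exists>h. tri C (FO i_shriek X) X
        (FO j_star (FO (verdier_fctr C \<N>) X)) (\<epsilon>' X) (\<theta>' X) h"
    using rec unfolding recollement_def Let_def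
  proof (elim conjE exE, goal_cases)
    case (1 \<eta> \<epsilon> \<eta>' \<epsilon>' \<theta> \<delta> \<theta>' \<delta>')
    show ?case
    proof (rule 1(1)[OF 1(14,15,17)], rule ballI)
      fix X assume X: "X \<in> Obj C"
      show "\<exists>h. tri C (FO i_shriek X) X
          (FO j_star (FO (verdier_fctr C \<N>) X)) (\<epsilon>' X) (\<theta>' X) h"
        using conjunct1[OF bspec[OF 1(18) X]] by (simp add: incl_fctr_def)
    qed
  qed
  have tc: "triangulated_category (full_sub C \<N>)" "triangulated_category (verdier C \<N>)"
    using basic(3,4) unfolding triangle_functor_def by blast+
  show ?thesis
    by (rule that[OF recollement_with_cotorsion_pair.intro[OF basic(1) tc
            recollement_with_cotorsion_pair_axioms.intro[OF basic(2,4) basic(5)[rule_format]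
              adj bspec[OF glue] SV]]])
qed

theorem proposition6p21:
  fixes C :: "('o, 'm) tricat"
    and \<N> \<S> \<V> :: "'o set"
    and i_star i_shriek :: "('o, 'm, 'o, 'm) fctr"
    and j_shriek j_star :: "('o, ('m \<times> 'm) set, 'o, 'm) fctr"
    and P :: "'o tcp"
    and \<sigma> \<omega> \<Theta> :: "('o, 'm set, 'o, 'm set) fctr"
  assumes recollement: "recollement C \<N> i_star i_shriek j_shriek j_star"
    and cotorsion_pair: "(\<S>, \<V>) \<in> cotorsion_pairs (full_sub C \<N>)"
    and P: "P = associated_tcp C i_star i_shriek \<S> \<V>"
    and sigma: "is_sigma C P \<sigma>"
    and omega: "is_omega C P \<omega>"
    and angle: "is_angle C P \<Theta>"
  shows "M_tcp C P \<sigma> \<omega> \<Theta> = M_pair C \<N> \<S> \<V> \<and>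
    R_pair C \<N> \<S> \<V> = R_tcp C \<N> P \<sigma> \<omega> \<Theta> \<and>
    I_pair C \<N> i_star i_shriek \<S> \<V> = I_tcp C \<N> P"
proof -
  obtain \<eta> \<epsilon> \<eta>' \<epsilon>' \<theta> \<delta> where
    "recollement_with_cotorsion_pair C \<N> (verdier C \<N>) (verdier_fctr C \<N>) i_star i_shriek j_star
      \<eta> \<epsilon> \<eta>' \<epsilon>' \<theta> \<delta> \<S> \<V>"
    by (rule recollement_obtain_adjunctions[OF recollement cotorsion_pair])
  then interpret recollement_with_cotorsion_pair C \<N> "verdier C \<N>" "verdier_fctr C \<N>"
    i_star i_shriek j_star \<eta> \<epsilon> \<eta>' \<epsilon>' \<theta> \<delta> \<S> \<V> .
  have P': "P = ((\<S>, preimage C i_shriek \<V>), (preimage C i_star \<S>, \<V>))"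
    using P by (simp add: associated_tcp_def)
  note ext = ext1_ZI_zero_iff[OF sigma[unfolded P'] omega[unfolded P'] angle[unfolded P']]
  have M: "M_tcp C P \<sigma> \<omega> \<Theta> = M_pair C \<N> \<S> \<V>"
  proof -
    have "(\<A>, \<B>) \<in> M_tcp C P \<sigma> \<omega> \<Theta> \<longleftrightarrow> (\<A>, \<B>) \<in> M_pair C \<N> \<S> \<V>" for \<A> \<B>
      unfolding P' M_tcp.simps M_pair_def mem_Collect_eq case_prod_conv
      using ext[of \<A> \<B>] preimage_i_star_eq preimage_i_shriek_eq by metis
    then show ?thesis by (intro equalityI subrelI) blast+
  qed
  moreover have "I_pair C \<N> i_star i_shriek \<S> \<V> = I_tcp C \<N> P"
    unfolding P' I_pair_def I_tcp.simps ..
  ultimately show ?thesis by (simp add: R_pair_def R_tcp_def)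
qed

end
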